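(* Suppose that $L(x)$ is a real-valued function that is defined, positive, and increasing for $x\ge 2$, that $L(2x)\sim L(x)$ as $x\to\infty$, and that $$\int_2^\infty\frac{dt}{t\log t\cdot L(t)}<\infty.$$ Then there is a primitive set $\mathcal S$ of positive integers such that its counting function $S(x)$ satisfies $$S(x) \asymp \frac{x}{\log_2 x \cdot \log_3 x \cdot L(\log_2 x)}$$ for all sufficiently large $x$. In particular, for any integer $\ell\ge 3$ and every real number $\varepsilon>0$, there exists a primitive set $\mathcal S$ of positive integers such that $$S(x) \asymp \frac{x}{\log_2 x \cdots \log_{\ell-1} x \cdot (\log_\ell x)^{1+\varepsilon}}$$ for all sufficiently large $x$.
   Context: A set of positive integers is primitive if no element of the set is a multiple of another (distinct) element of the set. For a set $\mathcal S$ of positive integers, $S(x)$ denotes the number of elements of $\mathcal S$ not exceeding $x$. Here $\log_1 x=\max\{1,\log x\}$ and $\log_\ell x=\log_1(\log_{\ell-1}x)$ for every integer $\ell\ge2$ (iterated natural logarithms, not logarithms to base $\ell$); $\log$ is the natural logarithm. The notation $f(x)\asymp g(x)$ means that there are positive constants $c,C$ (independent of $x$) with $c\,g(x)\le f(x)\le C\,g(x)$ for all $x$ in the stated range. In the last display with $\ell=3$, the denominator is $\log_2 x\cdot(\log_3 x)^{1+\varepsilon}$. *)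

theory Defs
  imports "HOL-Analysis.Analysis" "HOL-Library.Landau_Symbols"
begin

definition primitive_set :: "nat set \<Rightarrow> bool" where
  "primitive_set S \<longleftrightarrow> 0 \<notin> S \<and> (\<forall>a\<in>S. \<forall>b\<in>S. a \<noteq> b \<longrightarrow> \<not> a dvd b)"

definition counting_fun :: "nat set \<Rightarrow> real \<Rightarrow> real" where
  "counting_fun S x = real (card {n \<in> S. real n \<le> x})"

text \<open>
  Iterated (not base-\<open>l\<close>) natural logarithms, truncated below at 1. Starting the recursion
  with the identity at index 0 makes \<open>iter_log 1 x = max 1 (ln x)\<close>.
\<close>

primrec iter_log :: "nat \<Rightarrow> real \<Rightarrow> real" where
  "iter_log 0 x = x"
| "iter_log (Suc l) x = max 1 (ln (iter_log l x))"

definition same_order_at_top :: "(real \<Rightarrow> real) \<Rightarrow> (real \<Rightarrow> real) \<Rightarrow> bool" where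
  "same_order_at_top f g \<longleftrightarrow>
     (\<exists>c>0. \<exists>C>0. eventually (\<lambda>x. c * g x \<le> f x \<and> f x \<le> C * g x) at_top)"

end

theory Submission
  imports Defs "HOL-Computational_Algebra.Primes" "HOL-Real_Asymp.Real_Asymp"
begin

text \<open>
  Let \<open>W y = y * ln y * L y\<close> and choose distinct primes \<open>q k\<close> of order \<open>W k\<close>; the integral condition makes
  the sum of \<open>1 / q k\<close> finite, and at most \<open>1 / 4\<close> over a tail \<open>k \<ge> k0\<close>. Let \<open>S\<close> consist of the \<open>n\<close> which, with
  \<open>k\<close> the number of prime factors of \<open>n\<close> (with multiplicity), are divisible by \<open>q k\<close> but by no \<open>q j\<close> with
  \<open>k0 \<le> j < k\<close>, and satisfy \<open>k \<ge> c * ln (ln n)\<close>. If \<open>m\<close> properly divides \<open>n\<close>, then \<open>m\<close> has fewer prime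
  factors, so its prime \<open>q j\<close> cannot divide \<open>n\<close>, and \<open>S\<close> is primitive. An element \<open>n = q k * m\<close> is determined by
  its cofactor \<open>m\<close>, since \<open>m\<close> has \<open>k - 1\<close> prime factors. Up to \<open>x\<close> only \<open>k\<close> of order \<open>ln (ln x)\<close> or larger
  matter, so there are \<open>O(x / W (ln (ln x)))\<close> cofactors. Conversely, by the theorem of Hardy and Ramanujan (in
  Turan's form, resting on Chebyshev's and Mertens' estimates) a positive proportion of all \<open>m\<close> avoid every
  \<open>q j\<close> and have between \<open>c1 * ln (ln x)\<close> and \<open>C1 * ln (ln x)\<close> prime factors, and each of them is a cofactor.
\<close>

section \<open>Prime sums\<close>

definition primes_upto :: "nat \<Rightarrow> nat set" where
  "primes_upto n = {p. prime p \<and> p \<le> n}"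

definition theta :: "nat \<Rightarrow> real" where
  "theta n = (\<Sum>p\<in>primes_upto n. ln (real p))"

definition log_recip_sum :: "nat \<Rightarrow> real" where
  "log_recip_sum n = (\<Sum>p\<in>primes_upto n. ln (real p) / real p)"

definition recip_sum :: "nat \<Rightarrow> real" where
  "recip_sum n = (\<Sum>p\<in>primes_upto n. 1 / real p)"

lemma finite_primes_upto [simp]: "finite (primes_upto n)"
  unfolding primes_upto_def by (rule finite_subset[of _ "{..n}"]) auto

lemma primes_upto_mono: "m \<le> n \<Longrightarrow> primes_upto m \<subseteq> primes_upto n"
  by (auto simp: primes_upto_def)

lemma in_primes_uptoD: "p \<in> primes_upto n \<Longrightarrow> prime p \<and> 2 \<le> p \<and> p \<le> n"
  by (auto simp: primes_upto_def prime_ge_2_nat)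

lemma theta_mono: "m \<le> n \<Longrightarrow> theta m \<le> theta n"
  unfolding theta_def
  by (rule sum_mono2) (use primes_upto_mono in \<open>auto dest!: in_primes_uptoD\<close>)

lemma recip_sum_mono: "m \<le> n \<Longrightarrow> recip_sum m \<le> recip_sum n"
  unfolding recip_sum_def
  by (rule sum_mono2) (use primes_upto_mono in \<open>auto dest!: in_primes_uptoD\<close>)

section \<open>Chebyshev's upper bound for \<open>theta\<close>\<close>

lemma prod_primes_dvd:
  fixes A :: "nat set"
  assumes "finite A" "\<And>p. p \<in> A \<Longrightarrow> prime p \<and> p dvd n"
  shows "\<Prod>A dvd n"
  using assms
proof (induction A)
  case (insert p A)
  have "coprime p (\<Prod>A)"
    using insert by (intro prod_coprime_right) (auto intro!: primes_coprime)
  with insert show ?case by (simp add: divides_mult)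
qed simp

lemma sum_of_bool_eq_card:
  "finite A \<Longrightarrow> (\<Sum>x\<in>A. of_bool (P x)) = of_nat (card {x \<in> A. P x})"
  by (simp add: sum_of_bool_eq Collect_conj_eq)

text \<open>Every prime in \<open>(n, 2 * n]\<close> divides the central binomial coefficient: it
  divides the numerator \<open>fact (2 * n)\<close> but not \<open>fact n\<close>. Hence the product
  of these primes is at most \<open>4 ^ n\<close>.\<close>

lemma theta_double_le: "theta (2 * n) \<le> theta n + real n * ln 4"
proof -
  define A where "A = primes_upto (2 * n) - primes_upto n"
  have A: "prime p \<and> n < p \<and> p \<le> 2 * n" if "p \<in> A" for p
    using that by (auto simp: A_def primes_upto_def)
  have finA: "finite A" by (simp add: A_def)
  have "p dvd (2 * n choose n)" if "p \<in> A" for p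
  proof -
    have "p dvd fact (2 * n)" "\<not> p dvd fact n"
      using A[OF that] by (auto simp: prime_dvd_fact_iff)
    moreover have "fact (2 * n) = fact n * fact n * (2 * n choose n)"
      using binomial_fact_lemma[of n "2 * n"] by simp
    ultimately show ?thesis using A[OF that] by (simp add: prime_dvd_mult_iff)
  qed
  then have "\<Prod>A dvd (2 * n choose n)"
    using A finA by (intro prod_primes_dvd) (auto dest: prime_gt_0_nat)
  then have "\<Prod>A \<le> (2 * n choose n)"
    by (intro dvd_imp_le) (auto simp: zero_less_binomial)
  also have "\<dots> \<le> 4 ^ n"
  proof -
    have "(2 * n choose n) \<le> (\<Sum>k\<le>2 * n. 2 * n choose k)"
      by (rule member_le_sum) auto
    then show ?thesis by (simp add: choose_row_sum power_mult)
  qed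
  finally have "real (\<Prod>A) \<le> 4 ^ n" by (metis of_nat_le_iff of_nat_numeral of_nat_power)
  moreover have "0 < real (\<Prod>A)"
    using A by (force intro!: prod_pos dest: prime_gt_0_nat)
  ultimately have "ln (real (\<Prod>A)) \<le> ln (4 ^ n)" by (subst ln_le_cancel_iff) auto
  moreover have "ln (real (\<Prod>A)) = (\<Sum>p\<in>A. ln (real p))"
    using A finA by (subst of_nat_prod, subst ln_prod) (auto dest: prime_gt_0_nat)
  moreover have "theta (2 * n) = theta n + (\<Sum>p\<in>A. ln (real p))"
    unfolding theta_def A_def using primes_upto_mono[of n "2 * n"]
    by (subst sum_diff) auto
  ultimately show ?thesis by (simp add: ln_realpow)
qed

lemma theta_power2_le: "theta (2 ^ k) \<le> 2 ^ k * ln 4"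
proof (induction k)
  case 0
  have "primes_upto 1 = {}" by (auto dest: in_primes_uptoD)
  then show ?case by (simp add: theta_def)
next
  case (Suc k)
  then show ?case using theta_double_le[of "2 ^ k"] by simp
qed

text \<open>Rounding \<open>n\<close> up to a power of two costs a factor 2, and
  \<open>ln 4 \<le> 2\<close> supplies the other one.\<close>

lemma theta_le: "theta n \<le> 4 * real n"
proof (cases "n = 0")
  case True
  have "primes_upto 0 = {}" by (auto dest: in_primes_uptoD)
  with True show ?thesis by (simp add: theta_def)
next
  case False
  then obtain k where k: "2 ^ k \<le> n" "n < 2 ^ (k + 1)"
    using ex_power_ivl1[of 2 n] by auto
  have "ln 4 = 2 * ln (2::real)" using ln_realpow[of 2 2] by simp
  then have l4: "ln 4 \<le> (2::real)" using ln_2_less_1 by simp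
  have "theta n \<le> theta (2 ^ (k + 1))" using k by (intro theta_mono) simp
  also have "\<dots> \<le> 2 ^ (k + 1) * ln 4" by (rule theta_power2_le)
  also have "\<dots> \<le> 2 ^ (k + 1) * 2" using l4 by (intro mult_left_mono) auto
  also have "\<dots> = 4 * real (2 ^ k)" by simp
  also have "\<dots> \<le> 4 * real n" using k by (intro mult_left_mono) (auto simp del: of_nat_power)
  finally show ?thesis .
qed

section \<open>Legendre's formula and Mertens' first estimate\<close>

lemma card_multiples: "d > 0 \<Longrightarrow> card {m \<in> {1..n}. d dvd m} = n div d" for d n :: nat
proof -
  assume d: "d > 0"
  have "{m \<in> {1..n}. d dvd m} = (*) d ` {1..n div d}"
  proof (intro subset_antisym subsetI)
    fix m assume "m \<in> {m \<in> {1..n}. d dvd m}"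
    then obtain k where "m = d * k" "1 \<le> m" "m \<le> n" by auto
    then show "m \<in> (*) d ` {1..n div d}"
      using d by (auto simp: less_eq_div_iff_mult_less_eq mult.commute intro!: image_eqI[of _ _ k])
  qed (use d in \<open>auto simp: less_eq_div_iff_mult_less_eq mult.commute\<close>)
  moreover have "inj_on ((*) d) {1..n div d}" using d by (auto simp: inj_on_def)
  ultimately show ?thesis by (simp add: card_image)
qed

lemma real_div_le: "real (n div d) \<le> real n / real d"
  by (metis of_nat_div_le_of_nat)

lemma real_div_ge: "d > 0 \<Longrightarrow> real n / real d - 1 \<le> real (n div d)"
proof -
  assume d: "d > 0"
  have "n < d * (n div d + 1)" using d by (simp add: dividend_less_times_div)
  then have "real n < real d * (real (n div d) + 1)"
    by (metis of_nat_less_iff of_nat_mult of_nat_add of_nat_1)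
  then show ?thesis using d by (simp add: field_simps)
qed

text \<open>Legendre's formula, by counting the pairs \<open>(a, m)\<close> with
  \<open>p ^ a dvd m\<close> in two ways. An exponent of \<open>p\<close> in \<open>m\<close> is
  smaller than \<open>m\<close>, so letting \<open>a\<close> run only up to \<open>n\<close> loses
  nothing.\<close>

lemma sum_multiplicity:
  assumes p: "prime p"
  shows "(\<Sum>m\<in>{1..n}. multiplicity p m) = (\<Sum>a\<in>{1..n}. n div p ^ a)"
proof -
  have p2: "2 \<le> p" using p prime_ge_2_nat by blast
  have "multiplicity p m = (\<Sum>a\<in>{1..n}. of_bool (p ^ a dvd m))" if m: "m \<in> {1..n}" for m
  proof -
    have m0: "m \<noteq> 0" using m by auto
    have "multiplicity p m < p ^ multiplicity p m"
      using p2 by (intro power_gt_expt) auto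
    also have "\<dots> \<le> m" using m0 by (intro dvd_imp_le multiplicity_dvd) auto
    finally have le: "multiplicity p m \<le> n" using m by auto
    have "p ^ a dvd m \<longleftrightarrow> a \<le> multiplicity p m" for a
      using m0 p2 p by (intro power_dvd_iff_le_multiplicity) auto
    then have "{a \<in> {1..n}. p ^ a dvd m} = {a \<in> {1..n}. a \<le> multiplicity p m}" by simp
    also have "\<dots> = {1..multiplicity p m}" using le by auto
    finally have "card {a \<in> {1..n}. p ^ a dvd m} = multiplicity p m" by simp
    then show ?thesis by (subst sum_of_bool_eq_card) auto
  qed
  then have "(\<Sum>m\<in>{1..n}. multiplicity p m) = (\<Sum>m\<in>{1..n}. \<Sum>a\<in>{1..n}. of_bool (p ^ a dvd m))"
    by (rule sum.cong[OF refl])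
  also have "\<dots> = (\<Sum>a\<in>{1..n}. \<Sum>m\<in>{1..n}. of_bool (p ^ a dvd m))"
    by (rule sum.swap)
  also have "\<dots> = (\<Sum>a\<in>{1..n}. n div p ^ a)"
  proof (rule sum.cong[OF refl])
    fix a
    have "card {m \<in> {1..n}. p ^ a dvd m} = n div p ^ a"
      using p2 by (intro card_multiples) auto
    then show "(\<Sum>m\<in>{1..n}. of_bool (p ^ a dvd m)) = n div p ^ a"
      by (subst sum_of_bool_eq_card) auto
  qed
  finally show ?thesis .
qed

lemma sum_multiplicity_le:
  assumes p: "prime p"
  shows "real (\<Sum>m\<in>{1..n}. multiplicity p m) \<le> real n / (real p - 1)"
proof -
  have p2: "2 \<le> real p" using p prime_ge_2_nat by fastforce
  \<comment> \<open>The finite geometric series, multiplied by \<open>p - 1\<close> so that it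
    telescopes.\<close>
  have geo: "(real p - 1) * (\<Sum>a\<in>{1..N}. 1 / real p ^ a) = 1 - 1 / real p ^ N" for N
  proof (induction N)
    case (Suc N)
    have "(real p - 1) / real p ^ Suc N = 1 / real p ^ N - 1 / real p ^ Suc N"
      using p2 by (simp add: field_simps)
    with Suc show ?case by (simp add: distrib_left)
  qed simp
  have "(\<Sum>a\<in>{1..n}. 1 / real p ^ a) \<le> 1 / (real p - 1)"
  proof -
    have "(\<Sum>a\<in>{1..n}. 1 / real p ^ a) * (real p - 1) \<le> 1"
      using geo[of n] p2 by (simp add: mult.commute)
    then show ?thesis using p2 by (subst pos_le_divide_eq) auto
  qed
  then have "real n * (\<Sum>a\<in>{1..n}. 1 / real p ^ a) \<le> real n * (1 / (real p - 1))"
    by (rule mult_left_mono) simp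
  moreover have "real (n div p ^ a) \<le> real n * (1 / real p ^ a)" for a
    using real_div_le[of n "p ^ a"] by simp
  then have "(\<Sum>a\<in>{1..n}. real (n div p ^ a)) \<le> (\<Sum>a\<in>{1..n}. real n * (1 / real p ^ a))"
    by (rule sum_mono)
  ultimately show ?thesis
    unfolding sum_multiplicity[OF p] by (simp add: sum_distrib_left)
qed

lemma sum_multiplicity_ge:
  assumes p: "prime p"
  shows "real n / real p - 1 \<le> real (\<Sum>m\<in>{1..n}. multiplicity p m)"
proof (cases "n = 0")
  case False
  have p2: "p > 0" using p prime_gt_0_nat by auto
  have "n div p ^ 1 \<le> (\<Sum>a\<in>{1..n}. n div p ^ a)"
    using False by (intro member_le_sum[where f="\<lambda>a. n div p ^ a"]) auto
  then have "real (n div p) \<le> real (\<Sum>m\<in>{1..n}. multiplicity p m)"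
    unfolding sum_multiplicity[OF p] by (simp del: of_nat_sum)
  then show ?thesis using real_div_ge[OF p2, of n] by linarith
qed simp

lemma prime_factorization_subset_primes_upto:
  "m \<in> {1..n} \<Longrightarrow> prime_factors m \<subseteq> primes_upto n"
  by (auto simp: primes_upto_def prime_factors_dvd dest!: dvd_imp_le)

lemma ln_eq_sum_multiplicity:
  assumes m: "m \<in> {1..n}"
  shows "ln (real m) = (\<Sum>p\<in>primes_upto n. real (multiplicity p m) * ln (real p))"
proof -
  have "m = (\<Prod>p\<in>prime_factors m. p ^ multiplicity p m)"
    using m by (intro prime_factorization_nat) auto
  then have "ln (real m) = ln (\<Prod>p\<in>prime_factors m. real p ^ multiplicity p m)"
    by (metis (no_types, lifting) of_nat_power of_nat_prod prod.cong)
  also have "\<dots> = (\<Sum>p\<in>prime_factors m. ln (real p ^ multiplicity p m))"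
    by (subst ln_prod) (auto dest: in_prime_factors_imp_prime prime_gt_0_nat)
  also have "\<dots> = (\<Sum>p\<in>prime_factors m. real (multiplicity p m) * ln (real p))"
    by (intro sum.cong) (auto simp: ln_realpow dest: in_prime_factors_imp_prime prime_gt_0_nat)
  also have "\<dots> = (\<Sum>p\<in>primes_upto n. real (multiplicity p m) * ln (real p))"
    using m prime_factorization_subset_primes_upto[OF m]
    by (intro sum.mono_neutral_left)
       (auto simp: prime_factors_multiplicity primes_upto_def)
  finally show ?thesis .
qed

lemma ln_fact_eq:
  "ln (fact n :: real) = (\<Sum>p\<in>primes_upto n. real (\<Sum>m\<in>{1..n}. multiplicity p m) * ln (real p))"
proof -
  have "ln (fact n :: real) = (\<Sum>m\<in>{1..n}. ln (real m))"
    by (subst fact_prod, subst of_nat_prod, subst ln_prod) auto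
  also have "\<dots> = (\<Sum>m\<in>{1..n}. \<Sum>p\<in>primes_upto n. real (multiplicity p m) * ln (real p))"
    by (intro sum.cong refl ln_eq_sum_multiplicity)
  also have "\<dots> = (\<Sum>p\<in>primes_upto n. \<Sum>m\<in>{1..n}. real (multiplicity p m) * ln (real p))"
    by (rule sum.swap)
  finally show ?thesis by (simp add: sum_distrib_right)
qed

lemma ln_fact_le: "ln (fact n :: real) \<le> real n * ln (real n)"
proof -
  have "ln (fact n :: real) \<le> ln (real n ^ n)"
  proof (cases "n = 0")
    case False
    then show ?thesis using fact_le_power[where ?'a=real, of n] by (subst ln_le_cancel_iff) auto
  qed simp
  then show ?thesis by (cases "n = 0") (auto simp: ln_realpow)
qed

text \<open>The quotient \<open>n ^ n / fact n\<close> is a single term of the exponential series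
  for \<open>exp n\<close>, whose terms are all nonnegative.\<close>

lemma ln_fact_ge: "real n * ln (real n) - real n \<le> ln (fact n :: real)"
proof (cases "n = 0")
  case False
  have "real n ^ n / fact n \<le> exp (real n)"
  proof -
    have s: "(\<lambda>k. real n ^ k /\<^sub>R fact k) sums exp (real n)" by (rule exp_converges)
    have "(\<Sum>k\<in>{n}. real n ^ k /\<^sub>R fact k) \<le> (\<Sum>k. real n ^ k /\<^sub>R fact k)"
      using s by (intro sum_le_suminf) (auto simp: sums_iff)
    then show ?thesis using s by (simp add: sums_iff divide_inverse mult.commute)
  qed
  then have "real n ^ n \<le> exp (real n) * fact n" by (simp add: field_simps)
  then have "ln (real n ^ n) \<le> ln (exp (real n) * fact n)"
    using False by (subst ln_le_cancel_iff) auto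
  then show ?thesis using False by (simp add: ln_realpow ln_mult)
qed simp

text \<open>Upper half of Mertens' first theorem. In \<open>ln (fact n)\<close> each prime
  contributes at least \<open>(n / p - 1) * ln p\<close>; the rounding terms add up to
  \<open>theta n \<le> 4 * n\<close>, whence the constant 4.\<close>

lemma log_recip_sum_le: "n \<ge> 1 \<Longrightarrow> log_recip_sum n \<le> ln (real n) + 4"
proof -
  assume n: "n \<ge> 1"
  have "real n * log_recip_sum n - theta n
      = (\<Sum>p\<in>primes_upto n. (real n / real p - 1) * ln (real p))"
    unfolding log_recip_sum_def theta_def sum_distrib_left sum_subtractf[symmetric]
    by (intro sum.cong) (auto simp: algebra_simps)
  also have "\<dots> \<le> ln (fact n)"
    unfolding ln_fact_eq
    by (intro sum_mono mult_right_mono sum_multiplicity_ge)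
       (auto dest!: in_primes_uptoD)
  also have "\<dots> \<le> real n * ln (real n)" by (rule ln_fact_le)
  finally have "real n * log_recip_sum n \<le> real n * (ln (real n) + 4)"
    using theta_le[of n] by (simp add: algebra_simps)
  then show ?thesis using n by simp
qed

lemma summable_ln_div: "summable (\<lambda>n. ln (real n) / (real n * (real n - 1)))"
proof (rule summable_comparison_test_bigo)
  show "summable (\<lambda>n. norm (real n powr (- 3 / 2)))"
    using summable_real_powr_iff[of "- 3 / 2"] by simp
  show "(\<lambda>n. ln (real n) / (real n * (real n - 1))) \<in> O(\<lambda>n. real n powr (- 3 / 2))"
    by real_asymp
qed

text \<open>Lower half of Mertens' first theorem. Since
  \<open>1 / (p - 1) = 1 / p + 1 / (p * (p - 1))\<close>, the prime powers add a series that
  converges even when extended to all integers.\<close>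

lemma log_recip_sum_ge: "\<exists>E. \<forall>n\<ge>1. ln (real n) - E \<le> log_recip_sum n"
proof -
  let ?f = "\<lambda>n. ln (real n) / (real n * (real n - 1))"
  have "ln (real n) - (1 + suminf ?f) \<le> log_recip_sum n" if n: "n \<ge> 1" for n
  proof -
    have "real n * ln (real n) - real n \<le> ln (fact n)" by (rule ln_fact_ge)
    also have "\<dots> \<le> (\<Sum>p\<in>primes_upto n. real n / (real p - 1) * ln (real p))"
      unfolding ln_fact_eq
      by (intro sum_mono mult_right_mono sum_multiplicity_le)
         (auto dest!: in_primes_uptoD)
    also have "\<dots> = (\<Sum>p\<in>primes_upto n. real n * (ln (real p) / real p) + real n * ?f p)"
    proof (intro sum.cong refl)
      fix p assume "p \<in> primes_upto n"
      then have "2 \<le> real p" by (auto dest: in_primes_uptoD)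
      then show "real n / (real p - 1) * ln (real p) = real n * (ln (real p) / real p) + real n * ?f p"
        by (simp add: divide_simps) (simp add: algebra_simps)
    qed
    also have "\<dots> = real n * log_recip_sum n + real n * (\<Sum>p\<in>primes_upto n. ?f p)"
      by (simp add: log_recip_sum_def sum.distrib sum_distrib_left)
    also have "\<dots> \<le> real n * log_recip_sum n + real n * suminf ?f"
    proof -
      have "?f m \<ge> 0" for m
        by (cases "m = 0") (auto intro!: divide_nonneg_nonneg mult_nonneg_nonneg)
      then show ?thesis
        by (intro add_left_mono mult_left_mono sum_le_suminf summable_ln_div) auto
    qed
    finally have "real n * (ln (real n) - (1 + suminf ?f)) \<le> real n * log_recip_sum n"
      by (simp add: algebra_simps)
    then show ?thesis using n by simp
  qed
  then show ?thesis by blast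
qed

section \<open>Normal order of the number of prime factors\<close>

definition big_omega :: "nat \<Rightarrow> nat" where
  "big_omega n = size (prime_factorization n)"

section \<open>Primes in intervals and the growth of \<open>recip_sum\<close>\<close>

lemma log_recip_sum_diff_bounds:
  obtains E :: real where "E \<ge> 0"
    "\<And>m n. 1 \<le> m \<Longrightarrow> m \<le> n \<Longrightarrow>
       \<bar>(\<Sum>p\<in>primes_upto n - primes_upto m. ln (real p) / real p) - ln (real n / real m)\<bar> \<le> E"
proof -
  obtain E where E: "\<And>n. n \<ge> 1 \<Longrightarrow> ln (real n) - E \<le> log_recip_sum n"
    using log_recip_sum_ge by blast
  have "\<bar>(\<Sum>p\<in>primes_upto n - primes_upto m. ln (real p) / real p) - ln (real n / real m)\<bar> \<le> 4 + \<bar>E\<bar>"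
    if mn: "1 \<le> m" "m \<le> n" for m n
  proof -
    have "(\<Sum>p\<in>primes_upto n - primes_upto m. ln (real p) / real p) = log_recip_sum n - log_recip_sum m"
      unfolding log_recip_sum_def using primes_upto_mono[OF mn(2)] by (subst sum_diff) auto
    then show ?thesis
      using E[of n] E[of m] log_recip_sum_le[of n] log_recip_sum_le[of m] mn
      by (simp add: ln_div)
  qed
  then show ?thesis using that[of "4 + \<bar>E\<bar>"] by auto
qed

text \<open>Once \<open>ln A\<close> exceeds the Mertens error by 1, the sum of
  \<open>ln p / p\<close> over \<open>(n, A * n]\<close> is at least 1, while each term is at most
  \<open>ln (A * n) / n\<close>. This lower bound of Chebyshev type later keeps the chosen primes
  from growing too fast.\<close>

lemma many_primes_between:
  obtains A :: nat where "A \<ge> 2"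
    "\<And>n. n \<ge> 1 \<Longrightarrow> real n \<le> ln (real (A * n)) * real (card (primes_upto (A * n) - primes_upto n))"
proof -
  obtain E where E: "E \<ge> 0" "\<And>m n. 1 \<le> m \<Longrightarrow> m \<le> n \<Longrightarrow>
       \<bar>(\<Sum>p\<in>primes_upto n - primes_upto m. ln (real p) / real p) - ln (real n / real m)\<bar> \<le> E"
    using log_recip_sum_diff_bounds by blast
  define A where "A = nat \<lceil>exp (E + 1)\<rceil> + 2"
  have "exp (E + 1) \<le> real A" unfolding A_def by linarith
  then have lnA: "E + 1 \<le> ln (real A)"
    by (subst ln_ge_iff) (rule less_le_trans[OF exp_gt_zero])
  have "real n \<le> ln (real (A * n)) * real (card (primes_upto (A * n) - primes_upto n))" if n: "n \<ge> 1" for n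
  proof -
    let ?B = "primes_upto (A * n) - primes_upto n"
    have "1 \<le> (\<Sum>p\<in>?B. ln (real p) / real p)"
    proof -
      have "real (A * n) / real n = real A" using n by simp
      moreover have "n \<le> A * n" by (simp add: A_def)
      ultimately show ?thesis using E(2)[of n "A * n"] n lnA by (simp del: of_nat_mult)
    qed
    also have "\<dots> \<le> (\<Sum>p\<in>?B. ln (real (A * n)) / real n)"
    proof (rule sum_mono)
      fix p assume "p \<in> ?B"
      then have "n < p" "p \<le> A * n" by (auto simp: primes_upto_def)
      moreover have "0 < A" by (simp add: A_def)
      ultimately have "ln (real p) \<le> ln (real (A * n))" using n
        by (subst ln_le_cancel_iff) (simp_all del: of_nat_mult)
      then show "ln (real p) / real p \<le> ln (real (A * n)) / real n"
        using \<open>n < p\<close> n \<open>0 < A\<close> by (intro frac_le) (auto intro!: ln_ge_zero simp del: of_nat_mult)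
    qed
    finally show ?thesis using n by (simp add: field_simps)
  qed
  then show ?thesis using that[of A] by (simp add: A_def)
qed

text \<open>Squaring the argument changes \<open>recip_sum\<close> by an amount bounded above and below, so \<open>recip_sum\<close> grows
  linearly in \<open>i\<close> along the scale \<open>2 ^ 2 ^ i\<close>.\<close>

lemma recip_sum_square_diff:
  obtains D :: real and n0 :: nat where "D > 0"
    "\<And>n. n \<ge> 2 \<Longrightarrow> recip_sum (n\<^sup>2) \<le> recip_sum n + D"
    "\<And>n. n \<ge> n0 \<Longrightarrow> recip_sum n + 1 / 4 \<le> recip_sum (n\<^sup>2)"
proof -
  obtain E where E: "E \<ge> 0" "\<And>m n. 1 \<le> m \<Longrightarrow> m \<le> n \<Longrightarrow>
       \<bar>(\<Sum>p\<in>primes_upto n - primes_upto m. ln (real p) / real p) - ln (real n / real m)\<bar> \<le> E"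
    using log_recip_sum_diff_bounds by blast
  have le: "n \<le> n\<^sup>2" for n :: nat by (simp add: power2_eq_square)
  have eq: "recip_sum (n\<^sup>2) = recip_sum n + (\<Sum>p\<in>primes_upto (n\<^sup>2) - primes_upto n. 1 / real p)" for n
    unfolding recip_sum_def using primes_upto_mono[OF le] by (subst sum_diff) auto
  have mem: "n < p \<and> p \<le> n\<^sup>2" if "p \<in> primes_upto (n\<^sup>2) - primes_upto n" for p n
    using that by (auto simp: primes_upto_def)
  have *: "\<bar>(\<Sum>p\<in>primes_upto (n\<^sup>2) - primes_upto n. ln (real p) / real p) - ln (real n)\<bar> \<le> E"
    if "n \<ge> 2" for n
    using E(2)[of n "n\<^sup>2"] that le[of n] by (simp add: power2_eq_square)
  \<comment> \<open>On \<open>(n, n^2]\<close> the factor \<open>ln p\<close> lies between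
    \<open>ln n\<close> and \<open>2 * ln n\<close>, and the Mertens sum there is
    \<open>ln n\<close> up to \<open>E\<close>. Dividing by these two values gives the upper and the
    lower bound.\<close>
  have up: "recip_sum (n\<^sup>2) \<le> recip_sum n + (1 + E / ln 2)" if n: "n \<ge> 2" for n
  proof -
    have "ln (real n) * (\<Sum>p\<in>primes_upto (n\<^sup>2) - primes_upto n. 1 / real p)
        \<le> (\<Sum>p\<in>primes_upto (n\<^sup>2) - primes_upto n. ln (real p) / real p)"
      unfolding sum_distrib_left
    proof (intro sum_mono)
      fix p assume "p \<in> primes_upto (n\<^sup>2) - primes_upto n"
      then have "n < p" using mem by auto
      then have "ln (real n) \<le> ln (real p)" using n by simp
      then show "ln (real n) * (1 / real p) \<le> ln (real p) / real p"
        by (simp add: divide_right_mono)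
    qed
    also have "\<dots> \<le> ln (real n) + E" using *[OF n] by simp
    finally have "(\<Sum>p\<in>primes_upto (n\<^sup>2) - primes_upto n. 1 / real p) \<le> 1 + E / ln (real n)"
      using n by (simp add: field_simps)
    also have "\<dots> \<le> 1 + E / ln 2"
      using n E(1) by (intro add_left_mono divide_left_mono) auto
    finally show ?thesis by (simp add: eq)
  qed
  \<comment> \<open>Beyond \<open>n0\<close> the error \<open>E\<close> is at most half of
    \<open>ln n\<close>; half of \<open>ln n\<close> divided by \<open>2 * ln n\<close> is the
    \<open>1 / 4\<close> of the claim.\<close>
  define n0 where "n0 = nat \<lceil>exp (2 * E)\<rceil> + 2"
  have low: "recip_sum n + 1 / 4 \<le> recip_sum (n\<^sup>2)" if n: "n \<ge> n0" for n
  proof -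
    have n2: "n \<ge> 2" using n by (simp add: n0_def)
    have "exp (2 * E) \<le> real n" using n unfolding n0_def by linarith
    then have lnn: "2 * E \<le> ln (real n)" using n2 by (subst ln_ge_iff) auto
    have "ln (real n) / 2 \<le> (\<Sum>p\<in>primes_upto (n\<^sup>2) - primes_upto n. ln (real p) / real p)"
      using *[OF n2] lnn by simp
    also have "\<dots> \<le> (2 * ln (real n)) * (\<Sum>p\<in>primes_upto (n\<^sup>2) - primes_upto n. 1 / real p)"
      unfolding sum_distrib_left
    proof (intro sum_mono)
      fix p assume "p \<in> primes_upto (n\<^sup>2) - primes_upto n"
      then have p: "n < p" "p \<le> n\<^sup>2" using mem by auto
      have "ln (real p) \<le> ln ((real n)\<^sup>2)"
        using p n2 by (subst ln_le_cancel_iff) (auto simp flip: of_nat_power)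
      then have "ln (real p) \<le> 2 * ln (real n)" using n2 by (simp add: ln_realpow)
      then show "ln (real p) / real p \<le> 2 * ln (real n) * (1 / real p)"
        using p by (simp add: divide_right_mono)
    qed
    finally show ?thesis using n2 by (simp add: eq field_simps)
  qed
  show ?thesis using E(1)
    by (intro that[of "1 + E / ln 2" n0] up low) (auto intro!: add_pos_nonneg)
qed

lemma ln_ln_at_top: "filterlim (\<lambda>n. ln (ln (real n))) at_top sequentially"
  by real_asymp

text \<open>Round \<open>n\<close> down to a power of two, then round its exponent down to a power
  of two. The resulting \<open>i\<close> has the order of \<open>ln (ln n)\<close>; the different
  coefficients 1 and \<open>ln 2\<close> are harmless for bounds up to constants.\<close>

lemma double_power2_bracket:
  fixes n :: nat
  assumes n: "n \<ge> 2"
  obtains i :: nat where "2 ^ 2 ^ i \<le> n" "n < 2 ^ 2 ^ Suc i"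
    "ln (ln (real n)) - 1 \<le> real i" "real i * ln 2 \<le> ln (ln (real n)) - ln (ln 2)"
proof -
  obtain k where k: "2 ^ k \<le> n" "n < 2 ^ (k + 1)"
    using ex_power_ivl1[of 2 n] n by auto
  have "k \<noteq> 0" using k n by (intro notI) auto
  then obtain i where i: "2 ^ i \<le> k" "k < 2 ^ (i + 1)"
    using ex_power_ivl1[of 2 k] by auto
  have 1: "2 ^ 2 ^ i \<le> n"
    by (rule order.trans[OF power_increasing[OF i(1)] k(1)]) simp
  have 2: "n < 2 ^ 2 ^ Suc i"
    using i(2) by (intro less_le_trans[OF k(2) power_increasing]) simp_all
  have "ln ((2::real) ^ 2 ^ i) \<le> ln (real n)"
  proof (subst ln_le_cancel_iff)
    show "(2::real) ^ 2 ^ i \<le> real n"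
      using 1 by (metis of_nat_le_iff of_nat_numeral of_nat_power)
  qed (use n in simp_all)
  then have 3: "2 ^ i * ln 2 \<le> ln (real n)" by (simp add: ln_realpow)
  then have "ln (2 ^ i * ln 2) \<le> ln (ln (real n))"
    using n by (subst ln_le_cancel_iff) auto
  then have 4: "real i * ln 2 \<le> ln (ln (real n)) - ln (ln 2)"
    by (simp add: ln_mult ln_realpow)
  have "real n < 2 ^ 2 ^ Suc i"
    using 2 by (metis of_nat_less_iff of_nat_numeral of_nat_power)
  then have "ln (real n) < ln ((2::real) ^ 2 ^ Suc i)"
    using n by (subst ln_less_cancel_iff) auto
  then have "ln (real n) < 2 ^ Suc i * ln 2" by (simp add: ln_realpow)
  also have "\<dots> \<le> 2 ^ Suc i * 1" using ln_2_less_1 by (intro mult_left_mono) auto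
  finally have "ln (ln (real n)) \<le> ln (2 ^ Suc i)"
    using n by (subst ln_le_cancel_iff) auto
  also have "\<dots> = real (Suc i) * ln 2" by (rule ln_realpow)
  also have "\<dots> \<le> real (Suc i) * 1" using ln_2_less_1 by (intro mult_left_mono) auto
  finally have "ln (ln (real n)) - 1 \<le> real i" by simp
  with 1 2 4 show ?thesis using that by blast
qed

lemma recip_sum_bounds:
  obtains c C :: real where "c > 0" "C > 0"
    "\<forall>\<^sub>F n in sequentially. c * ln (ln (real n)) \<le> recip_sum n \<and> recip_sum n \<le> C * ln (ln (real n))"
proof -
  obtain D n0 where D: "D > 0"
    "\<And>n. n \<ge> 2 \<Longrightarrow> recip_sum (n\<^sup>2) \<le> recip_sum n + D"
    "\<And>n. n \<ge> n0 \<Longrightarrow> recip_sum n + 1 / 4 \<le> recip_sum (n\<^sup>2)"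
    using recip_sum_square_diff by blast
  have sq: "(2::nat) ^ 2 ^ Suc i = (2 ^ 2 ^ i)\<^sup>2" for i
    by (simp add: power_mult[symmetric] mult.commute)
  have y2: "(2::nat) \<le> 2 ^ 2 ^ i" for i
    using power_increasing[of 1 "2 ^ i" "2::nat"] by simp
  \<comment> \<open>Ensures that from \<open>i = n0\<close> on the argument \<open>2 ^ 2 ^ i\<close>
    is past the threshold of the lower squaring bound.\<close>
  have yi: "i \<le> 2 ^ 2 ^ i" for i
    using less_exp[of i] less_exp[of "2 ^ i"] by linarith
  have up: "recip_sum (2 ^ 2 ^ i) \<le> recip_sum 2 + real i * D" for i
  proof (induction i)
    case (Suc i)
    then show ?case using D(2)[OF y2[of i]] by (simp only: sq) (simp add: algebra_simps)
  qed simp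
  have low: "(real i - real n0) / 4 \<le> recip_sum (2 ^ 2 ^ i)" if "i \<ge> n0" for i
    using that
  proof (induction i rule: dec_induct)
    case base
    show ?case by (simp add: recip_sum_def sum_nonneg)
  next
    case (step i)
    have "n0 \<le> 2 ^ 2 ^ i" using step(1) yi[of i] by linarith
    then show ?case using D(3)[of "2 ^ 2 ^ i"] step.IH by (simp only: sq) (simp add: field_simps)
  qed
  define C where "C = D / ln 2 + 1"
  define b where "b = recip_sum 2 + D - D * ln (ln 2) / ln 2"
  have C: "C > 0" using D(1) by (simp add: C_def add_pos_pos)
  \<comment> \<open>The threshold absorbs the constant \<open>b\<close> above, and below it halves
    the slope \<open>1 / 4\<close> to \<open>1 / 8\<close> in order to pay for the offset
    \<open>n0 + 1\<close>.\<close>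
  have "\<forall>\<^sub>F n in sequentially. ln (ln (real n)) \<ge> \<bar>b\<bar> + 8 + 2 * real n0"
    using ln_ln_at_top by (simp add: filterlim_at_top)
  then have "\<forall>\<^sub>F n in sequentially. 1 / 8 * ln (ln (real n)) \<le> recip_sum n \<and> recip_sum n \<le> C * ln (ln (real n))"
    using eventually_ge_at_top[of 2]
  proof eventually_elim
    case (elim n)
    obtain i where i: "2 ^ 2 ^ i \<le> n" "n < 2 ^ 2 ^ Suc i"
      "ln (ln (real n)) - 1 \<le> real i" "real i * ln 2 \<le> ln (ln (real n)) - ln (ln 2)"
      using double_power2_bracket[OF elim(2)] by blast
    have "recip_sum n \<le> recip_sum 2 + real (Suc i) * D"
      using up[of "Suc i"] recip_sum_mono[of n "2 ^ 2 ^ Suc i"] i(2) by linarith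
    also have "\<dots> \<le> recip_sum 2 + ((ln (ln (real n)) - ln (ln 2)) / ln 2 + 1) * D"
      using i(4) D(1) by (intro add_left_mono mult_right_mono) (auto simp: field_simps)
    also have "\<dots> = D / ln 2 * ln (ln (real n)) + b" by (simp add: b_def field_simps)
    also have "\<dots> \<le> C * ln (ln (real n))" using elim by (simp add: C_def algebra_simps)
    finally have u: "recip_sum n \<le> C * ln (ln (real n))" .
    have "(real i - real n0) / 4 \<le> recip_sum n"
      using low[of i] recip_sum_mono[OF i(1)] i(3) elim by linarith
    moreover have "ln (ln (real n)) \<ge> 2 + 2 * real n0" using elim(1) by linarith
    ultimately have "1 / 8 * ln (ln (real n)) \<le> recip_sum n" using i(3) by (simp add: field_simps)
    with u show ?case by simp
  qed
  then show ?thesis using that[of "1 / 8" C] C by simp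
qed

section \<open>Mean and variance of the number of prime factors\<close>

lemma big_omega_eq_sum:
  assumes m: "m \<in> {1..n}"
  shows "big_omega m = (\<Sum>p\<in>primes_upto n. multiplicity p m)"
proof -
  have "big_omega m = (\<Sum>p\<in>prime_factors m. multiplicity p m)"
    unfolding big_omega_def size_multiset_overloaded_eq
    by (intro sum.cong) (auto simp: count_prime_factorization_prime dest: in_prime_factors_imp_prime)
  also have "\<dots> = (\<Sum>p\<in>primes_upto n. multiplicity p m)"
    using m prime_factorization_subset_primes_upto[OF m]
    by (intro sum.mono_neutral_left) (auto simp: prime_factors_multiplicity primes_upto_def)
  finally show ?thesis .
qed

lemma sum_big_omega_le: "(\<Sum>m\<in>{1..n}. real (big_omega m)) \<le> 2 * real n * recip_sum n"
proof -
  have "(\<Sum>m\<in>{1..n}. real (big_omega m)) = (\<Sum>m\<in>{1..n}. \<Sum>p\<in>primes_upto n. real (multiplicity p m))"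
    by (intro sum.cong refl) (simp only: big_omega_eq_sum of_nat_sum)
  also have "\<dots> = (\<Sum>p\<in>primes_upto n. real (\<Sum>m\<in>{1..n}. multiplicity p m))"
    by (subst sum.swap) simp
  also have "\<dots> \<le> (\<Sum>p\<in>primes_upto n. 2 * real n * (1 / real p))"
  proof (rule sum_mono)
    fix p assume "p \<in> primes_upto n"
    then have p: "prime p" "2 \<le> p" by (auto dest: in_primes_uptoD)
    have "real (\<Sum>m\<in>{1..n}. multiplicity p m) \<le> real n / (real p - 1)"
      using p by (intro sum_multiplicity_le)
    also have "\<dots> \<le> real n / (real p / 2)"
      using p by (intro divide_left_mono) auto
    finally show "real (\<Sum>m\<in>{1..n}. multiplicity p m) \<le> 2 * real n * (1 / real p)"
      by (simp add: mult.commute)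
  qed
  finally show ?thesis by (simp add: recip_sum_def sum_distrib_left)
qed

lemma markov_card:
  fixes f :: "'a \<Rightarrow> real"
  assumes "finite A" "\<And>x. x \<in> A \<Longrightarrow> f x \<ge> 0" "\<And>x. x \<in> B \<Longrightarrow> f x \<ge> t" "B \<subseteq> A"
  shows "real (card B) * t \<le> sum f A"
proof -
  have "real (card B) * t = (\<Sum>x\<in>B. t)" by simp
  also have "\<dots> \<le> sum f B" using assms by (intro sum_mono) auto
  also have "\<dots> \<le> sum f A" using assms by (intro sum_mono2) auto
  finally show ?thesis .
qed

text \<open>Markov's inequality: the mean of \<open>big_omega\<close> is at most
  \<open>2 * recip_sum n\<close>, and the threshold is eight times that.\<close>

lemma card_big_omega_large:
  assumes "recip_sum n > 0"
  shows "real (card {m \<in> {1..n}. real (big_omega m) > 16 * recip_sum n}) \<le> real n / 8"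
proof -
  have "real (card {m \<in> {1..n}. real (big_omega m) > 16 * recip_sum n}) * (16 * recip_sum n)
      \<le> (\<Sum>m\<in>{1..n}. real (big_omega m))"
    by (intro markov_card) auto
  also have "\<dots> \<le> 2 * real n * recip_sum n" by (rule sum_big_omega_le)
  finally show ?thesis using assms by (simp add: field_simps)
qed

text \<open>For \<open>1 \<le> m \<le> n\<close> this counts the distinct prime factors of
  \<open>m\<close>. A sum of indicators lets the moments be computed by exchanging sums, and it
  bounds \<open>big_omega\<close> from below, which suits the lower tail.\<close>

definition small_omega_upto :: "nat \<Rightarrow> nat \<Rightarrow> real" where
  "small_omega_upto n m = (\<Sum>p\<in>primes_upto n. of_bool (p dvd m))"

lemma small_omega_upto_le:
  assumes m: "m \<in> {1..n}"
  shows "small_omega_upto n m \<le> real (big_omega m)"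
proof -
  have "small_omega_upto n m \<le> (\<Sum>p\<in>primes_upto n. real (multiplicity p m))"
    unfolding small_omega_upto_def
  proof (rule sum_mono)
    fix p assume "p \<in> primes_upto n"
    then have "prime p" by (auto dest: in_primes_uptoD)
    then show "of_bool (p dvd m) \<le> real (multiplicity p m)"
      using m by (auto simp: prime_multiplicity_gt_zero_iff Suc_le_eq of_bool_def)
  qed
  then show ?thesis by (simp add: big_omega_eq_sum[OF m])
qed

text \<open>There are at most \<open>n\<close> primes up to \<open>n\<close>, so the rounding errors in \<open>n div p\<close> add up to at most \<open>n\<close>; hence the
  usual truncation to small primes is not needed.\<close>

lemma turan_variance:
  "(\<Sum>m\<in>{1..n}. (small_omega_upto n m - recip_sum n)\<^sup>2) \<le> 3 * real n * recip_sum n"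
proof -
  let ?P = "recip_sum n" and ?A = "primes_upto n"
  have P0: "?P \<ge> 0" by (simp add: recip_sum_def sum_nonneg)
  have cnt: "(\<Sum>m\<in>{1..n}. of_bool (d dvd m) :: real) = real (n div d)" if "d > 0" for d
    using card_multiples[OF that] by (subst sum_of_bool_eq_card) auto
  have "(\<Sum>m\<in>{1..n}. small_omega_upto n m) = (\<Sum>p\<in>?A. \<Sum>m\<in>{1..n}. of_bool (p dvd m))"
    unfolding small_omega_upto_def by (rule sum.swap)
  also have "\<dots> = (\<Sum>p\<in>?A. real (n div p))"
    by (intro sum.cong refl cnt) (auto dest: in_primes_uptoD)
  finally have sum_omega: "(\<Sum>m\<in>{1..n}. small_omega_upto n m) = (\<Sum>p\<in>?A. real (n div p))" .
  have "?A \<subseteq> {1..n}" by (auto dest: in_primes_uptoD)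
  then have cardA: "card ?A \<le> n" using card_mono[of "{1..n}" ?A] by simp
  have "real n * ?P - real n \<le> real n * ?P - real (card ?A)" using cardA by simp
  also have "\<dots> = (\<Sum>p\<in>?A. real n / real p - 1)"
    by (simp add: sum_subtractf recip_sum_def sum_distrib_left)
  also have "\<dots> \<le> (\<Sum>p\<in>?A. real (n div p))"
    by (intro sum_mono real_div_ge) (auto dest: in_primes_uptoD)
  finally have first: "(\<Sum>m\<in>{1..n}. small_omega_upto n m) \<ge> real n * ?P - real n"
    unfolding sum_omega .
  have "(\<Sum>m\<in>{1..n}. (small_omega_upto n m)\<^sup>2)
      = (\<Sum>m\<in>{1..n}. \<Sum>p\<in>?A. \<Sum>q\<in>?A. of_bool (p dvd m \<and> q dvd m))"
    unfolding small_omega_upto_def power2_eq_square sum_product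
    by (intro sum.cong refl) (simp only: of_bool_conj)
  also have "\<dots> = (\<Sum>p\<in>?A. \<Sum>q\<in>?A. \<Sum>m\<in>{1..n}. of_bool (p dvd m \<and> q dvd m))"
    by (subst sum.swap, rule sum.cong[OF refl], rule sum.swap)
  also have "\<dots> \<le> (\<Sum>p\<in>?A. \<Sum>q\<in>?A. real n * (1 / real p) * (1 / real q) + (if q = p then real n * (1 / real p) else 0))"
  proof (intro sum_mono)
    fix p q assume "p \<in> ?A" "q \<in> ?A"
    then have pq: "prime p" "prime q" "p > 0" "q > 0" by (auto dest: in_primes_uptoD)
    show "(\<Sum>m\<in>{1..n}. of_bool (p dvd m \<and> q dvd m))
      \<le> real n * (1 / real p) * (1 / real q) + (if q = p then real n * (1 / real p) else 0)"
    proof (cases "q = p")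
      case True
      have "(\<Sum>m\<in>{1..n}. of_bool (p dvd m \<and> q dvd m)) = real (n div p)"
        using cnt[OF pq(3)] True by simp
      then show ?thesis using real_div_le[of n p] True by (simp add: add_increasing)
    next
      case False
      then have "coprime p q" using pq by (intro primes_coprime) auto
      then have "p dvd m \<and> q dvd m \<longleftrightarrow> p * q dvd m" for m
        by (auto intro: divides_mult dvd_mult_left dvd_mult_right)
      then have "(\<Sum>m\<in>{1..n}. of_bool (p dvd m \<and> q dvd m)) = real (n div (p * q))"
        using cnt[of "p * q"] pq by simp
      then show ?thesis using real_div_le[of n "p * q"] False by simp
    qed
  qed
  also have "\<dots> = (\<Sum>p\<in>?A. \<Sum>q\<in>?A. real n * (1 / real p) * (1 / real q)) + (\<Sum>p\<in>?A. real n * (1 / real p))"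
    by (simp only: sum.distrib sum.delta' finite_primes_upto) simp
  also have "(\<Sum>p\<in>?A. \<Sum>q\<in>?A. real n * (1 / real p) * (1 / real q)) = (\<Sum>p\<in>?A. real n * (1 / real p) * ?P)"
    by (simp only: recip_sum_def sum_distrib_left)
  also have "\<dots> = (\<Sum>p\<in>?A. real n * (1 / real p)) * ?P"
    by (simp only: sum_distrib_right)
  also have "(\<Sum>p\<in>?A. real n * (1 / real p)) = real n * ?P"
    by (simp only: recip_sum_def sum_distrib_left)
  finally have second: "(\<Sum>m\<in>{1..n}. (small_omega_upto n m)\<^sup>2) \<le> real n * ?P * ?P + real n * ?P" .
  have "(\<Sum>m\<in>{1..n}. (small_omega_upto n m - ?P)\<^sup>2)
      = (\<Sum>m\<in>{1..n}. (small_omega_upto n m)\<^sup>2 - 2 * ?P * small_omega_upto n m + ?P\<^sup>2)"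
    by (intro sum.cong refl) (simp add: power2_diff)
  also have "\<dots> = (\<Sum>m\<in>{1..n}. (small_omega_upto n m)\<^sup>2) - 2 * ?P * (\<Sum>m\<in>{1..n}. small_omega_upto n m) + real n * ?P\<^sup>2"
    by (simp only: sum.distrib sum_subtractf sum_distrib_left[symmetric] sum_constant card_atLeastAtMost) simp
  also have "\<dots> \<le> (real n * ?P * ?P + real n * ?P) - 2 * ?P * (real n * ?P - real n) + real n * ?P\<^sup>2"
    using second first P0 by (intro add_right_mono diff_mono mult_left_mono) auto
  also have "\<dots> = 3 * real n * ?P" by (simp add: power2_eq_square algebra_simps)
  finally show ?thesis .
qed

text \<open>Chebyshev's inequality: a deviation of half the mean \<open>P\<close> has at most
  \<open>3 * n * P / (P / 2)^2 = 12 * n / P\<close> instances, and \<open>P \<ge> 96\<close> makes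
  this at most \<open>n / 8\<close>.\<close>

lemma card_big_omega_small:
  assumes "recip_sum n \<ge> 96"
  shows "real (card {m \<in> {1..n}. real (big_omega m) < recip_sum n / 2}) \<le> real n / 8"
proof -
  let ?P = "recip_sum n"
  have "(?P / 2)\<^sup>2 \<le> (small_omega_upto n m - ?P)\<^sup>2"
    if "m \<in> {m \<in> {1..n}. real (big_omega m) < ?P / 2}" for m
  proof -
    have "?P / 2 \<le> ?P - small_omega_upto n m" using that small_omega_upto_le[of m n] by auto
    then have "(?P / 2)\<^sup>2 \<le> (?P - small_omega_upto n m)\<^sup>2" using assms by (intro power_mono) auto
    then show ?thesis by (simp add: power2_commute)
  qed
  then have "real (card {m \<in> {1..n}. real (big_omega m) < ?P / 2}) * (?P / 2)\<^sup>2
      \<le> (\<Sum>m\<in>{1..n}. (small_omega_upto n m - ?P)\<^sup>2)"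
    by (intro markov_card) auto
  also have "\<dots> \<le> 3 * real n * ?P" by (rule turan_variance)
  finally have "real (card {m \<in> {1..n}. real (big_omega m) < ?P / 2}) * (?P / 2)\<^sup>2 \<le> 3 * real n * ?P" .
  then have "?P * (real (card {m \<in> {1..n}. real (big_omega m) < ?P / 2}) * ?P) \<le> ?P * (12 * real n)"
    by (simp only: power2_eq_square) (simp add: mult.commute mult.left_commute)
  then have "real (card {m \<in> {1..n}. real (big_omega m) < ?P / 2}) * ?P \<le> 12 * real n"
    using assms by (subst (asm) mult_le_cancel_left_pos) linarith
  moreover have "real (card {m \<in> {1..n}. real (big_omega m) < ?P / 2}) * 96
      \<le> real (card {m \<in> {1..n}. real (big_omega m) < ?P / 2}) * ?P"
    using assms by (intro mult_left_mono) auto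
  ultimately show ?thesis by simp
qed

lemma big_omega_normal_order:
  obtains c C :: real where "c > 0" "C > 0"
    "\<forall>\<^sub>F n in sequentially.
       real (card {m \<in> {1..n}. real (big_omega m) < c * ln (ln (real n))}) \<le> real n / 8 \<and>
       real (card {m \<in> {1..n}. real (big_omega m) > C * ln (ln (real n))}) \<le> real n / 8"
proof -
  obtain c C where cC: "c > 0" "C > 0"
    "\<forall>\<^sub>F n in sequentially. c * ln (ln (real n)) \<le> recip_sum n \<and> recip_sum n \<le> C * ln (ln (real n))"
    using recip_sum_bounds by blast
  have "\<forall>\<^sub>F n in sequentially. ln (ln (real n)) \<ge> 96 / c"
    using ln_ln_at_top by (simp add: filterlim_at_top)
  with cC(3) have "\<forall>\<^sub>F n in sequentially.
       real (card {m \<in> {1..n}. real (big_omega m) < c / 2 * ln (ln (real n))}) \<le> real n / 8 \<and>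
       real (card {m \<in> {1..n}. real (big_omega m) > 16 * C * ln (ln (real n))}) \<le> real n / 8"
  proof eventually_elim
    case (elim n)
    have P: "recip_sum n \<ge> 96" using elim cC(1) by (simp add: field_simps)
    have "card {m \<in> {1..n}. real (big_omega m) < c / 2 * ln (ln (real n))}
        \<le> card {m \<in> {1..n}. real (big_omega m) < recip_sum n / 2}"
      using elim by (intro card_mono) auto
    moreover have "card {m \<in> {1..n}. real (big_omega m) > 16 * C * ln (ln (real n))}
        \<le> card {m \<in> {1..n}. real (big_omega m) > 16 * recip_sum n}"
      using elim by (intro card_mono) auto
    ultimately show ?case
      using card_big_omega_small[OF P] card_big_omega_large[of n] P by linarith
  qed
  then show ?thesis using that[of "c / 2" "16 * C"] cC by simp
qed

section \<open>Sparse sequences of primes\<close>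

lemma infinite_primes: "infinite {p::nat. prime p}"
  using primes_infinite by simp

text \<open>\<open>enumerate\<close> counts from 0, so the primes with index at most
  \<open>i\<close> number \<open>i + 1\<close>; they cannot all be among the at most
  \<open>i\<close> primes up to \<open>n\<close>.\<close>

lemma enumerate_primes_gt:
  assumes "card (primes_upto n) \<le> i"
  shows "n < enumerate {p. prime p} i"
proof (rule ccontr)
  assume *: "\<not> n < enumerate {p::nat. prime p} i"
  have "enumerate {p. prime p} j \<in> primes_upto n" if "j \<le> i" for j
  proof -
    have "enumerate {p::nat. prime p} j \<le> enumerate {p. prime p} i"
      using that infinite_primes by simp
    moreover have "enumerate {p::nat. prime p} j \<in> {p. prime p}"
      by (rule enumerate_in_set[OF infinite_primes])
    ultimately show ?thesis using * by (simp add: primes_upto_def)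
  qed
  then have "enumerate {p. prime p} ` {..i} \<subseteq> primes_upto n" by auto
  then have "card (enumerate {p::nat. prime p} ` {..i}) \<le> card (primes_upto n)"
    by (intro card_mono) auto
  moreover have "card (enumerate {p::nat. prime p} ` {..i}) = i + 1"
    using inj_enumerate[OF infinite_primes] by (subst card_image) (auto intro: inj_on_subset)
  ultimately show False using assms by simp
qed

lemma enumerate_primes_le:
  assumes "i < card (primes_upto n)"
  shows "enumerate {p. prime p} i \<le> n"
proof (rule ccontr)
  assume *: "\<not> enumerate {p::nat. prime p} i \<le> n"
  have "primes_upto n \<subseteq> enumerate {p. prime p} ` {..<i}"
  proof
    fix p assume p: "p \<in> primes_upto n"
    then obtain j where j: "p = enumerate {p. prime p} j"
      using enumerate_Ex[OF infinite_primes, of p] by (auto simp: primes_upto_def)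
    with p * have "enumerate {p. prime p} j < enumerate {p::nat. prime p} i"
      by (auto simp: primes_upto_def)
    then have "j < i" using infinite_primes by simp
    with j show "p \<in> enumerate {p. prime p} ` {..<i}" by blast
  qed
  then have "card (primes_upto n) \<le> card (enumerate {p::nat. prime p} ` {..<i})"
    by (intro card_mono) auto
  also have "\<dots> \<le> i" using card_image_le[of "{..<i}"] by simp
  finally show False using assms by simp
qed

section \<open>Weights and the primes attached to them\<close>

lemma ln_le_half: "t > 0 \<Longrightarrow> ln t \<le> t / 2" for t :: real
  using ln_le_minus_one[of "t / 2"] ln_2_less_1 by (simp add: ln_div)

text \<open>Collects what the construction uses about the weight, so that the integral condition and
  the iterated logarithms can each be fed in directly. The bound \<open>lower\<close> guarantees
  that there are enough primes near \<open>W k\<close> to give each \<open>k\<close> its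
  own.\<close>

locale slow_weight =
  fixes W :: "real \<Rightarrow> real" and a c D :: real
  assumes a: "a \<ge> 2" and c: "c > 0"
    and mono: "\<And>x y. a \<le> x \<Longrightarrow> x \<le> y \<Longrightarrow> W x \<le> W y"
    and lower: "\<And>x. a \<le> x \<Longrightarrow> c * (x * ln x) \<le> W x"
    and doubling: "\<And>x. a \<le> x \<Longrightarrow> W (2 * x) \<le> D * W x"
    and summable: "summable (\<lambda>k. 1 / W (real k))"
begin

lemma pos: "a \<le> x \<Longrightarrow> W x > 0"
proof -
  assume "a \<le> x"
  then have "0 < c * (x * ln x)" using a c by simp
  with lower[OF \<open>a \<le> x\<close>] show ?thesis by linarith
qed

lemma D_ge_1: "D \<ge> 1"
proof -
  have "1 * W a \<le> W (2 * a)" using mono[of a "2 * a"] a by simp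
  also have "\<dots> \<le> D * W a" by (rule doubling) simp
  finally show ?thesis using pos[of a] by simp
qed

lemma doubling_power: "a \<le> x \<Longrightarrow> W (2 ^ s * x) \<le> D ^ s * W x"
proof (induction s)
  case (Suc s)
  have "1 * x \<le> 2 ^ s * x" using a Suc.prems by (intro mult_right_mono) auto
  then have "a \<le> 2 ^ s * x" using Suc.prems by linarith
  then have "W (2 ^ Suc s * x) \<le> D * W (2 ^ s * x)"
    using doubling[of "2 ^ s * x"] by (simp add: mult.assoc)
  also have "\<dots> \<le> D * (D ^ s * W x)" using Suc D_ge_1 by (intro mult_left_mono) auto
  finally show ?case by (simp add: mult.assoc)
qed simp

lemma scaling:
  obtains E where "E > 0" "\<And>x. a \<le> x \<Longrightarrow> a \<le> M * x \<Longrightarrow> W (M * x) \<le> E * W x"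
proof -
  obtain s where s: "M < 2 ^ s" using real_arch_pow[of 2 M] by auto
  have "W (M * x) \<le> D ^ s * W x" if x: "a \<le> x" "a \<le> M * x" for x
  proof -
    have "W (M * x) \<le> W (2 ^ s * x)"
      using x s a by (intro mono mult_right_mono) auto
    also have "\<dots> \<le> D ^ s * W x" by (rule doubling_power[OF x(1)])
    finally show ?thesis .
  qed
  then show ?thesis using that[of "D ^ s"] D_ge_1 by simp
qed

text \<open>Doubling makes \<open>W y\<close> at most exponential in \<open>y\<close>, against a
  double exponential. With \<open>x = exp (exp y)\<close> it says that any multiple of
  \<open>W (ln (ln x))\<close> is eventually below the fourth root of \<open>x\<close>.\<close>

lemma growth: "\<forall>\<^sub>F y in at_top. C * W y \<le> exp (exp y / 4)"
proof -
  define d where "d = ln D + 1"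
  define w where "w = ln (\<bar>C\<bar> * W a + 1)"
  have d: "d > 0" using D_ge_1 by (simp add: d_def add_nonneg_pos)
  have "\<forall>\<^sub>F y::real in at_top. w + (y + 1) * d \<le> exp y / 4"
    using d by real_asymp
  then show ?thesis using eventually_ge_at_top[of a]
  proof eventually_elim
    case (elim y)
    define n where "n = nat \<lceil>y\<rceil>"
    have n: "real n \<le> y + 1" "y \<le> real n" using elim(2) a by (auto simp: n_def)
    have "real n \<le> 2 ^ n" using of_nat_less_two_power[of n, where ?'a=real] by simp
    also have "\<dots> * 1 \<le> 2 ^ n * a" using a by (intro mult_left_mono) auto
    finally have "y \<le> 2 ^ n * a" using n by simp
    then have "W y \<le> W (2 ^ n * a)" using elim by (intro mono) auto
    also have "\<dots> \<le> D ^ n * W a" by (intro doubling_power) simp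
    finally have Wy: "W y \<le> D ^ n * W a" .
    have Wa: "W a > 0" by (rule pos) simp
    have Dn: "D ^ n \<le> exp ((y + 1) * d)"
    proof -
      have "D ^ n = exp (real n * ln D)"
        using D_ge_1 by (simp add: exp_of_nat_mult)
      moreover have "real n * ln D \<le> (y + 1) * d"
        using n D_ge_1 elim a unfolding d_def by (intro mult_mono) auto
      ultimately show ?thesis by simp
    qed
    have "C * W y \<le> \<bar>C\<bar> * W y" using pos[OF elim(2)] by (intro mult_right_mono) auto
    also have "\<dots> \<le> \<bar>C\<bar> * (D ^ n * W a)" using Wy by (intro mult_left_mono) auto
    also have "\<dots> \<le> D ^ n * (\<bar>C\<bar> * W a + 1)" using D_ge_1 by (simp add: algebra_simps)
    also have "\<dots> \<le> exp ((y + 1) * d) * (\<bar>C\<bar> * W a + 1)"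
      using Dn Wa by (intro mult_right_mono) auto
    also have "\<dots> = exp ((y + 1) * d) * exp w" unfolding w_def
      \<comment> \<open>The summand 1 in \<open>w\<close> keeps the argument of \<open>ln\<close>
        positive even if \<open>C = 0\<close>.\<close>
      using Wa by (subst exp_ln) (auto intro!: add_nonneg_pos)
    also have "\<dots> = exp (w + (y + 1) * d)"
      by (simp add: exp_add)
    also have "\<dots> \<le> exp (exp y / 4)" using elim by simp
    finally show ?case .
  qed
qed

text \<open>Taking for \<open>q k\<close> the prime with index \<open>\<pi> (N k) + k\<close>, where \<open>N k\<close> is a monotone multiple of \<open>W k\<close>, makes \<open>q\<close>
  strictly increasing.\<close>

lemma prime_sequence:
  obtains q :: "nat \<Rightarrow> nat" and k0 :: nat and b C :: real
  where "k0 \<ge> 1" "real k0 \<ge> a" "b > 0" "C > 0"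
    "\<And>k. k \<ge> k0 \<Longrightarrow> prime (q k)" "inj_on q {k0..}" "\<And>k. k \<le> q k"
    "\<And>k. k \<ge> k0 \<Longrightarrow> b * W (real k) \<le> real (q k)"
    "\<And>k. k \<ge> k0 \<Longrightarrow> real (q k) \<le> C * W (real k)"
    "\<And>n. (\<Sum>k\<in>{k0..<n}. 1 / real (q k)) \<le> 1 / 4"
proof -
  obtain A where A: "A \<ge> 2"
    "\<And>n. n \<ge> 1 \<Longrightarrow> real n \<le> ln (real (A * n)) * real (card (primes_upto (A * n) - primes_upto n))"
    using many_primes_between by blast
  \<comment> \<open>With this factor \<open>N k \<ge> 3 * k * ln k\<close>, the margin that the
    upper bound \<open>q_le\<close> relies on.\<close>
  define b where "b = 3 / c"
  define N where "N k = nat \<lceil>b * W (real k)\<rceil>" for k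
  define q where "q k = enumerate {p::nat. prime p} (card (primes_upto (N k)) + k)" for k
  have b: "b > 0" using c by (simp add: b_def)
  have "summable (\<lambda>k. 1 / b * (1 / W (real k)))" by (intro summable_mult summable)
  then obtain K where K: "\<And>m n. m \<ge> K \<Longrightarrow> norm (\<Sum>k\<in>{m..<n}. 1 / b * (1 / W (real k))) < 1 / 4"
    unfolding summable_Cauchy by (meson zero_less_divide_1_iff zero_less_numeral)
  \<comment> \<open>Past \<open>K\<close> the tail sum is below \<open>1 / 4\<close>, past
    \<open>a\<close> the weight is monotone, and past \<open>A^2\<close> one has
    \<open>ln A < ln k / 2\<close>.\<close>
  define k0 where "k0 = K + nat \<lceil>a\<rceil> + A\<^sup>2 + 3"
  have k0: "k0 \<ge> 1" "k0 \<ge> K" "real k0 \<ge> a" "k0 > A\<^sup>2" unfolding k0_def by linarith+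
  have N: "real (N k) \<ge> b * W (real k)" "real (N k) \<le> b * W (real k) + 1" "real (N k) \<ge> 3 * (real k * ln (real k))"
    if k: "k \<ge> k0" for k
  proof -
    have ak: "a \<le> real k" using k k0 by linarith
    show 1: "real (N k) \<ge> b * W (real k)" unfolding N_def by linarith
    show "real (N k) \<le> b * W (real k) + 1"
      unfolding N_def using mult_pos_pos[OF b pos[OF ak]] by linarith
    have "b * (c * (real k * ln (real k))) \<le> b * W (real k)"
      using lower[OF ak] b by (intro mult_left_mono) auto
    then show "real (N k) \<ge> 3 * (real k * ln (real k))" using 1 c by (simp add: b_def)
  qed
  have N_mono: "N j \<le> N k" if "k0 \<le> j" "j \<le> k" for j k
    unfolding N_def using that k0 b
    by (intro nat_mono ceiling_mono mult_left_mono mono) auto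
  have prime_q: "prime (q k)" for k
    using enumerate_in_set[OF infinite_primes, of "card (primes_upto (N k)) + k"]
    unfolding q_def mem_Collect_eq .
  have q_less: "q j < q k" if "k0 \<le> j" "j < k" for j k
  proof -
    have "card (primes_upto (N j)) \<le> card (primes_upto (N k))"
      using that by (intro card_mono primes_upto_mono N_mono) auto
    then show ?thesis unfolding q_def using that by (intro enumerate_mono infinite_primes) auto
  qed
  have inj: "inj_on q {k0..}"
  proof (rule inj_onI)
    fix j k assume "j \<in> {k0..}" "k \<in> {k0..}" "q j = q k"
    then show "j = k" using q_less[of j k] q_less[of k j] by (cases j k rule: linorder_cases) auto
  qed
  have kq: "k \<le> q k" for k
    unfolding q_def using le_enumerate[OF infinite_primes, of "card (primes_upto (N k)) + k"] by linarith
  have N_less_q: "N k < q k" for k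
    unfolding q_def by (rule enumerate_primes_gt) simp
  have q_low: "b * W (real k) \<le> real (q k)" if "k \<ge> k0" for k
    using N(1)[OF that] N_less_q[of k] by linarith
  have q_le: "q k \<le> A * N k" if k: "k \<ge> k0" for k
  proof -
    have kA: "k > A\<^sup>2" using k k0 by linarith
    then have k3: "k > 0" by simp
    have "ln ((real A)\<^sup>2) < ln (real k)"
      using kA A(1) by (subst ln_less_cancel_iff) (auto simp flip: of_nat_power)
    then have lnA: "2 * ln (real A) < ln (real k)" using A(1) by (simp add: ln_realpow)
    have lnA0: "0 < ln (real A)" using A(1) by simp
    define t where "t = real (N k) / real k"
    have t: "t \<ge> 3 * ln (real k)" using N(3)[OF k] k3 by (simp add: t_def field_simps)
    have t0: "t > 0" using t lnA lnA0 by linarith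
    have Nt: "real (N k) = t * real k" using k3 by (simp add: t_def)
    have N1: "N k \<ge> 1" using t0 k3 Nt by (cases "N k = 0") auto
    \<comment> \<open>Here \<open>ln A + ln k < 3 / 2 * ln k \<le> t / 2\<close> and
      \<open>ln t \<le> t / 2\<close>. So \<open>many_primes_between\<close> yields at least
      \<open>N k / t = k\<close> primes in \<open>(N k, A * N k]\<close>.\<close>
    have "ln (real (A * N k)) = ln (real A) + (ln t + ln (real k))"
      using Nt A(1) t0 k3 by (simp add: ln_mult)
    also have "\<dots> < t" using ln_le_half[OF t0] t lnA lnA0 by linarith
    finally have less: "ln (real (A * N k)) < t" .
    have Ak: "N k \<le> A * N k" using A(1) by simp
    let ?d = "card (primes_upto (A * N k) - primes_upto (N k))"
    have "t * real k \<le> ln (real (A * N k)) * real ?d" using A(2)[OF N1] Nt by simp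
    also have "\<dots> \<le> t * real ?d" using less by (intro mult_right_mono) auto
    finally have kd: "k \<le> ?d" using t0 by simp
    \<comment> \<open>Strictness matters: indices start at 0, so the prime with index
      \<open>\<pi> (N k) + k\<close> is at most \<open>A * N k\<close> only if more than
      \<open>k\<close> primes lie in between.\<close>
    have "k < ?d"
    proof (rule ccontr)
      assume "\<not> k < ?d"
      then have "?d = k" using kd by simp
      then have "t * real k \<le> ln (real (A * N k)) * real k"
        using \<open>t * real k \<le> ln (real (A * N k)) * real ?d\<close> by simp
      then show False using less k3 by simp
    qed
    moreover have "?d = card (primes_upto (A * N k)) - card (primes_upto (N k))"
      using primes_upto_mono[OF Ak] by (intro card_Diff_subset) auto
    ultimately show ?thesis unfolding q_def by (intro enumerate_primes_le) linarith
  qed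
  \<comment> \<open>The term \<open>1 / W k0\<close> absorbs the 1 lost in the ceiling of
    \<open>N k\<close>.\<close>
  define C where "C = real A * (b + 1 / W (real k0))"
  have Wk0: "W (real k0) > 0" using k0 by (intro pos)
  have C: "C > 0" unfolding C_def using A(1) b Wk0 by (intro mult_pos_pos add_pos_pos) auto
  have q_up: "real (q k) \<le> C * W (real k)" if k: "k \<ge> k0" for k
  proof -
    have "W (real k0) \<le> W (real k)" using k k0 by (intro mono) auto
    then have "1 \<le> W (real k) / W (real k0)" using Wk0 by simp
    then have "real (N k) \<le> (b + 1 / W (real k0)) * W (real k)"
      using N(2)[OF k] by (simp add: distrib_right)
    then have "real A * real (N k) \<le> real A * ((b + 1 / W (real k0)) * W (real k))"
      by (intro mult_left_mono) auto
    moreover have "real (q k) \<le> real A * real (N k)"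
      using q_le[OF k] by (metis of_nat_le_iff of_nat_mult)
    ultimately show ?thesis by (simp add: C_def mult.assoc)
  qed
  have sum: "(\<Sum>k\<in>{k0..<n}. 1 / real (q k)) \<le> 1 / 4" for n
  proof -
    have "(\<Sum>k\<in>{k0..<n}. 1 / real (q k)) \<le> (\<Sum>k\<in>{k0..<n}. 1 / b * (1 / W (real k)))"
    proof (rule sum_mono)
      fix k assume "k \<in> {k0..<n}"
      then have k: "k \<ge> k0" by simp
      have "1 / real (q k) \<le> 1 / (b * W (real k))"
        using q_low[OF k] b pos[of "real k"] prime_gt_0_nat[OF prime_q[of k]] k k0 by (intro divide_left_mono mult_pos_pos) auto
      then show "1 / real (q k) \<le> 1 / b * (1 / W (real k))" by simp
    qed
    also have "\<dots> \<le> 1 / 4" using K[OF k0(2), of n] by (simp only: real_norm_def)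
    finally show ?thesis .
  qed
  show ?thesis
    using that[OF k0(1) k0(3) b C prime_q inj kq q_low q_up sum] by blast
qed

end

section \<open>The primitive set\<close>

lemma big_omega_mult: "m > 0 \<Longrightarrow> n > 0 \<Longrightarrow> big_omega (m * n) = big_omega m + big_omega n"
  by (simp add: big_omega_def prime_factorization_mult)

lemma big_omega_prime: "prime p \<Longrightarrow> big_omega p = 1"
  by (simp add: big_omega_def prime_factorization_prime)

lemma big_omega_pos: "n > 1 \<Longrightarrow> big_omega n > 0"
  by (auto simp: big_omega_def nonempty_has_size[symmetric] prime_factorization_empty_iff)

text \<open>Requiring \<open>c * ln (ln n) \<le> big_omega n\<close> removes the integers with few prime factors, whose number would
  otherwise have to be estimated in the upper bound.\<close>

definition tagged_set :: "(nat \<Rightarrow> nat) \<Rightarrow> nat \<Rightarrow> real \<Rightarrow> nat set" where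
  "tagged_set q k0 c = {n. n > 0 \<and> k0 \<le> big_omega n \<and> q (big_omega n) dvd n \<and>
     (\<forall>j\<in>{k0..<big_omega n}. \<not> q j dvd n) \<and> c * ln (ln (real n)) \<le> real (big_omega n)}"

lemma primitive_tagged_set: "primitive_set (tagged_set q k0 c)"
  unfolding primitive_set_def
proof (intro conjI ballI impI notI)
  fix m n assume m: "m \<in> tagged_set q k0 c" and n: "n \<in> tagged_set q k0 c"
    and "m \<noteq> n" "m dvd n"
  then obtain d where d: "n = m * d" by blast
  have "m > 0" "n > 0" using m n by (auto simp: tagged_set_def)
  then have "d > 1" using d \<open>m \<noteq> n\<close> by (cases "d = 0"; cases "d = 1") auto
  then have "big_omega m < big_omega n"
    using d \<open>m > 0\<close> big_omega_pos[of d] by (simp add: big_omega_mult)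
  moreover have "q (big_omega m) dvd n" "k0 \<le> big_omega m"
    using m \<open>m dvd n\<close> by (auto simp: tagged_set_def)
  ultimately show False using n by (auto simp: tagged_set_def)
qed (auto simp: tagged_set_def)

lemma counting_fun_finite: "finite {n \<in> S. real n \<le> x}"
  by (rule finite_subset[of _ "{..nat \<lfloor>x\<rfloor>}"]) (auto simp: le_nat_floor)

section \<open>Counting the primitive set\<close>

text \<open>Elements up to \<open>T\<close> are counted trivially. Beyond \<open>T\<close> they have
  at least \<open>K\<close> prime factors, so their tagging prime is at least \<open>z\<close> and
  the cofactor at most \<open>x / z\<close>; the cofactor determines the element because it has
  exactly one prime factor fewer.\<close>

lemma counting_tagged_set_le:
  assumes prime: "\<And>k. k \<ge> k0 \<Longrightarrow> prime (q k)" and k0: "k0 \<ge> 1"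
    and z: "z > 0" "\<And>k. k0 \<le> k \<Longrightarrow> K \<le> real k \<Longrightarrow> z \<le> real (q k)"
    and T: "T \<ge> 0" "\<And>n. n \<in> tagged_set q k0 c \<Longrightarrow> T < real n \<Longrightarrow> K \<le> real (big_omega n)"
    and x: "x \<ge> 0"
  shows "counting_fun (tagged_set q k0 c) x \<le> T + x / z"
proof -
  let ?S = "tagged_set q k0 c"
  define B where "B = {n \<in> ?S. T < real n \<and> real n \<le> x}"
  define f where "f n = n div q (big_omega n)" for n
  have finB: "finite B" unfolding B_def
    by (rule finite_subset[OF _ counting_fun_finite[of ?S x]]) auto
  have f: "n = q (big_omega n) * f n \<and> 1 \<le> f n \<and> real (f n) \<le> x / z \<and> big_omega n = Suc (big_omega (f n))"
    if n: "n \<in> B" for n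
  proof -
    let ?p = "q (big_omega n)"
    have S: "n > 0" "k0 \<le> big_omega n" "?p dvd n" "K \<le> real (big_omega n)" "real n \<le> x"
      using n T(2) by (auto simp: B_def tagged_set_def)
    have p: "prime ?p" "0 < ?p" using prime S(2) prime_gt_0_nat by auto
    have eq: "n = ?p * f n" using S(3) by (simp add: f_def)
    have f1: "1 \<le> f n" using eq S(1) by (cases "f n = 0") auto
    have "z * real (f n) \<le> real ?p * real (f n)" using z(2)[OF S(2,4)] by (intro mult_right_mono) auto
    also have "\<dots> = real n" by (metis eq of_nat_mult)
    also have "\<dots> \<le> x" by (rule S(5))
    finally have "real (f n) \<le> x / z" using z(1) by (simp add: field_simps)
    moreover have "big_omega (?p * f n) = Suc (big_omega (f n))"
      using f1 p by (simp add: big_omega_mult big_omega_prime)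
    ultimately show ?thesis using eq f1 by simp
  qed
  have "inj_on f B"
  proof (rule inj_onI)
    fix m n assume mn: "m \<in> B" "n \<in> B" "f m = f n"
    then have "big_omega m = big_omega n" using f[OF mn(1)] f[OF mn(2)] by simp
    then show "m = n" using f[OF mn(1)] f[OF mn(2)] mn(3) by metis
  qed
  moreover have "f ` B \<subseteq> {1..nat \<lfloor>x / z\<rfloor>}" using f by (auto simp: le_nat_floor)
  ultimately have "card B \<le> nat \<lfloor>x / z\<rfloor>"
    using card_inj_on_le[of f B "{1..nat \<lfloor>x / z\<rfloor>}"] by simp
  then have "real (card B) \<le> real (nat \<lfloor>x / z\<rfloor>)" by simp
  also have "\<dots> \<le> x / z" using x z(1) by (intro of_nat_floor) auto
  finally have 1: "real (card B) \<le> x / z" .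
  have "card {n \<in> ?S. real n \<le> x} \<le> card ({1..nat \<lfloor>T\<rfloor>} \<union> B)"
  proof (intro card_mono subsetI)
    fix n assume n: "n \<in> {n \<in> ?S. real n \<le> x}"
    then have "n > 0" by (simp add: tagged_set_def)
    with n show "n \<in> {1..nat \<lfloor>T\<rfloor>} \<union> B"
      by (cases "real n \<le> T") (auto simp: B_def le_nat_floor)
  qed (use finB in auto)
  also have "\<dots> \<le> nat \<lfloor>T\<rfloor> + card B" using card_Un_le[of "{1..nat \<lfloor>T\<rfloor>}" B] by simp
  finally have "counting_fun ?S x \<le> real (nat \<lfloor>T\<rfloor>) + real (card B)"
    by (simp add: counting_fun_def)
  also have "\<dots> \<le> T + x / z" using 1 T(1) of_nat_floor[of T] by linarith
  finally show ?thesis .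
qed

text \<open>Each \<open>m\<close> in \<open>G\<close> is multiplied by the prime belonging to
  \<open>big_omega m + 1\<close>, so the product carries its own tag. No earlier tag divides it:
  none divides \<open>m\<close>, and \<open>q\<close> is injective on \<open>{k0..}\<close>.\<close>

lemma counting_tagged_set_ge:
  assumes prime: "\<And>k. k \<ge> k0 \<Longrightarrow> prime (q k)" and inj: "inj_on q {k0..}" and c: "c \<ge> 0"
    and G: "\<And>m. m \<in> G \<Longrightarrow> m > 0 \<and> k0 \<le> big_omega m \<and> real (q (Suc (big_omega m)) * m) \<le> x \<and>
        c * ln (ln x) \<le> real (big_omega m) \<and> (\<forall>j\<ge>k0. \<not> q j dvd m)"
  shows "real (card G) \<le> counting_fun (tagged_set q k0 c) x"
proof -
  define f where "f m = q (Suc (big_omega m)) * m" for m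
  have f: "prime (q (Suc (big_omega m))) \<and> f m \<in> tagged_set q k0 c \<and> real (f m) \<le> x \<and>
      big_omega (f m) = Suc (big_omega m)" if m: "m \<in> G" for m
  proof -
    let ?k = "Suc (big_omega m)"
    have k: "k0 \<le> ?k" "m > 0" using G[OF m] by auto
    have p: "prime (q ?k)" using k by (intro prime) auto
    then have p2: "2 \<le> q ?k" by (rule prime_ge_2_nat)
    have om: "big_omega (f m) = ?k"
      using p p2 k by (simp add: f_def big_omega_mult big_omega_prime)
    have fx: "real (f m) \<le> x" using G[OF m] by (simp add: f_def)
    have fm: "2 * 1 \<le> f m" unfolding f_def using p2 k by (intro mult_le_mono) auto
    have "\<not> q j dvd f m" if j: "j \<in> {k0..<?k}" for j
    proof
      assume "q j dvd f m"
      then have "q j dvd q ?k \<or> q j dvd m"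
        using prime[of j] j by (auto simp: f_def prime_dvd_mult_iff)
      then have "q j = q ?k" using G[OF m] j p prime[of j] by (auto simp: primes_dvd_imp_eq)
      then have "j = ?k" using inj j k by (auto simp: inj_on_def)
      then show False using j by simp
    qed
    moreover have "c * ln (ln (real (f m))) \<le> c * ln (ln x)"
    proof (rule mult_left_mono[OF _ c])
      have "0 < ln (real (f m))" "ln (real (f m)) \<le> ln x" using fm fx by auto
      then show "ln (ln (real (f m))) \<le> ln (ln x)" by simp
    qed
    moreover have "c * ln (ln x) \<le> real ?k" "k0 \<le> ?k" using G[OF m] by auto
    moreover have "0 < f m" using fm by linarith
    moreover have "q ?k dvd f m" by (simp add: f_def)
    ultimately have "f m \<in> tagged_set q k0 c" using om by (simp add: tagged_set_def)
    then show ?thesis using p om fx by simp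
  qed
  have "inj_on f G"
  proof (rule inj_onI)
    fix m n assume mn: "m \<in> G" "n \<in> G" "f m = f n"
    then have "big_omega m = big_omega n" using f[OF mn(1)] f[OF mn(2)] by simp
    then show "m = n" using f[OF mn(1)] mn(3) by (auto simp: f_def)
  qed
  then have "card G \<le> card {n \<in> tagged_set q k0 c. real n \<le> x}"
    using f by (intro card_inj_on_le counting_fun_finite) auto
  then show ?thesis by (simp add: counting_fun_def)
qed

text \<open>Since \<open>k \<le> q k\<close>, only indices up to \<open>N\<close> can divide some
  \<open>m \<le> N\<close>, which turns the union into a finite one.\<close>

lemma card_multiples_of_sequence_le:
  fixes q :: "nat \<Rightarrow> nat"
  assumes q: "\<And>k. k \<ge> k0 \<Longrightarrow> q k > 0" "\<And>k. k \<le> q k"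
    and sum: "\<And>n. (\<Sum>k\<in>{k0..<n}. 1 / real (q k)) \<le> \<delta>"
  shows "real (card {m \<in> {1..N}. \<exists>j\<ge>k0. q j dvd m}) \<le> \<delta> * real N"
proof -
  have "{m \<in> {1..N}. \<exists>j\<ge>k0. q j dvd m} \<subseteq> (\<Union>j\<in>{k0..<Suc N}. {m \<in> {1..N}. q j dvd m})"
  proof
    fix m assume "m \<in> {m \<in> {1..N}. \<exists>j\<ge>k0. q j dvd m}"
    then obtain j where j: "m \<in> {1..N}" "k0 \<le> j" "q j dvd m" by auto
    then have "q j \<le> m" by (intro dvd_imp_le) auto
    then have "j < Suc N" using q(2)[of j] j(1) by simp
    with j show "m \<in> (\<Union>j\<in>{k0..<Suc N}. {m \<in> {1..N}. q j dvd m})" by auto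
  qed
  then have "card {m \<in> {1..N}. \<exists>j\<ge>k0. q j dvd m} \<le> card (\<Union>j\<in>{k0..<Suc N}. {m \<in> {1..N}. q j dvd m})"
    by (intro card_mono) auto
  also have "\<dots> \<le> (\<Sum>j\<in>{k0..<Suc N}. card {m \<in> {1..N}. q j dvd m})"
    by (rule card_UN_le) simp
  also have "\<dots> = (\<Sum>j\<in>{k0..<Suc N}. N div q j)"
    using q(1) by (intro sum.cong refl card_multiples) auto
  finally have "real (card {m \<in> {1..N}. \<exists>j\<ge>k0. q j dvd m}) \<le> (\<Sum>j\<in>{k0..<Suc N}. real (N div q j))"
    by (simp flip: of_nat_sum)
  also have "\<dots> \<le> (\<Sum>j\<in>{k0..<Suc N}. real N * (1 / real (q j)))"
    using real_div_le by (intro sum_mono) simp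
  also have "\<dots> \<le> real N * \<delta>"
    unfolding sum_distrib_left[symmetric] by (intro mult_left_mono sum) simp
  finally show ?thesis by (simp add: mult.commute)
qed

text \<open>Allows asymptotic conditions to be stated in \<open>y = ln (ln x)\<close>, with
  \<open>x\<close> recovered as \<open>exp (exp y)\<close>.\<close>

lemma eventually_ln_ln:
  fixes P :: "real \<Rightarrow> bool"
  assumes "eventually P at_top"
  shows "\<forall>\<^sub>F x in at_top. P (ln (ln x)) \<and> exp (exp (ln (ln x))) = x"
proof -
  have "filterlim (\<lambda>x::real. ln (ln x)) at_top at_top" by real_asymp
  then have "\<forall>\<^sub>F x in at_top. P (ln (ln x))"
    using assms by (rule eventually_compose_filterlim[rotated])
  then show ?thesis using eventually_gt_at_top[of 1]
    by eventually_elim simp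
qed

context slow_weight
begin

lemma primitive_set_exists:
  "\<exists>S. primitive_set S \<and> same_order_at_top (counting_fun S) (\<lambda>x. x / W (ln (ln x)))"
proof -
  obtain q k0 b C where q: "k0 \<ge> 1" "real k0 \<ge> a" "b > 0" "C > 0"
    "\<And>k. k \<ge> k0 \<Longrightarrow> prime (q k)" "inj_on q {k0..}" "\<And>k. k \<le> q k"
    "\<And>k. k \<ge> k0 \<Longrightarrow> b * W (real k) \<le> real (q k)"
    "\<And>k. k \<ge> k0 \<Longrightarrow> real (q k) \<le> C * W (real k)"
    "\<And>n. (\<Sum>k\<in>{k0..<n}. 1 / real (q k)) \<le> 1 / 4"
    by (rule prime_sequence) (rule that)
  obtain c1 C1 where normal: "c1 > 0" "C1 > 0"
    "\<forall>\<^sub>F n in sequentially.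
       real (card {m \<in> {1..n}. real (big_omega m) < c1 * ln (ln (real n))}) \<le> real n / 8 \<and>
       real (card {m \<in> {1..n}. real (big_omega m) > C1 * ln (ln (real n))}) \<le> real n / 8"
    using big_omega_normal_order by blast
  then obtain N0 where N0: "\<And>n. n \<ge> N0 \<Longrightarrow>
       real (card {m \<in> {1..n}. real (big_omega m) < c1 * ln (ln (real n))}) \<le> real n / 8 \<and>
       real (card {m \<in> {1..n}. real (big_omega m) > C1 * ln (ln (real n))}) \<le> real n / 8"
    unfolding eventually_sequentially by blast
  \<comment> \<open>The cofactors run up to some \<open>N\<close> below \<open>x\<close> with
    \<open>ln (ln N) \<ge> y / 2\<close>, so \<open>c1 * ln (ln N)\<close> is only known to reach
    \<open>g * y\<close>.\<close>
  define g where "g = c1 / 2"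
  have g: "g > 0" using normal by (simp add: g_def)
  define S where "S = tagged_set q k0 g"
  obtain E1 where E1: "E1 > 0" "\<And>x. a \<le> x \<Longrightarrow> a \<le> 2 / g * x \<Longrightarrow> W (2 / g * x) \<le> E1 * W x"
    using scaling[of "2 / g"] by blast
  obtain E2 where E2: "E2 > 0" "\<And>x. a \<le> x \<Longrightarrow> a \<le> (C1 + 1) * x \<Longrightarrow> W ((C1 + 1) * x) \<le> E2 * W x"
    using scaling[of "C1 + 1"] by blast
  have ln2: "0 < ln (2::real)" "ln (2::real) < 1" using ln_2_less_1 by auto
  have upper: "\<forall>\<^sub>F x in at_top. counting_fun S x \<le> (1 + E1 / b) * (x / W (ln (ln x)))"
  proof -
    have "\<forall>\<^sub>F y in at_top. a + 2 * a / g + 2 \<le> y \<and> 1 * W y \<le> exp (exp y / 4)"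
      by (intro eventually_conj growth eventually_ge_at_top)
    then have "\<forall>\<^sub>F x in at_top. (a + 2 * a / g + 2 \<le> ln (ln x) \<and> 1 * W (ln (ln x)) \<le> exp (exp (ln (ln x)) / 4))
        \<and> exp (exp (ln (ln x))) = x"
      by (rule eventually_ln_ln)
    then show ?thesis
    proof eventually_elim
      case (elim x)
      define y where "y = ln (ln x)"
      have y: "a + 2 * a / g + 2 \<le> y" "W y \<le> exp (exp y / 4)" and x: "x = exp (exp y)"
        using elim by (auto simp: y_def)
      have ag: "0 < 2 * a / g" using a g by simp
      have ya: "a \<le> y" "2 \<le> y" and ya2: "2 * a / g \<le> y" using y(1) ag a by linarith+
      have ga: "a \<le> g / 2 * y" using ya2 g by (simp add: field_simps)
      have Wy: "W y > 0" using ya by (intro pos)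
      have WK: "W (g / 2 * y) > 0" using ga by (intro pos)
      \<comment> \<open>The cut \<open>T\<close> is the square root of \<open>x\<close>. Above it
        \<open>ln (ln n) \<ge> y - ln 2 \<ge> y / 2\<close>, so the condition on
        \<open>big_omega\<close> in \<open>tagged_set\<close> gives
        \<open>K = g / 2 * y\<close>.\<close>
      have "counting_fun S x \<le> exp (exp y / 2) + x / (b * W (g / 2 * y))"
        unfolding S_def
      proof (rule counting_tagged_set_le[where K = "g / 2 * y"])
        show "b * W (g / 2 * y) \<le> real (q k)" if "k0 \<le> k" "g / 2 * y \<le> real k" for k
        proof -
          have "b * W (g / 2 * y) \<le> b * W (real k)"
            using that ga q(3) by (intro mult_left_mono mono) auto
          then show ?thesis using q(8)[OF that(1)] by linarith
        qed
        show "g / 2 * y \<le> real (big_omega n)" if n: "n \<in> tagged_set q k0 g" "exp (exp y / 2) < real n" for n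
        proof -
          have "exp y / 2 \<le> ln (real n)"
            using n by (subst ln_ge_iff) (auto simp: tagged_set_def)
          then have "ln (exp y / 2) \<le> ln (ln (real n))"
            by (subst ln_le_cancel_iff) (auto intro: less_le_trans[of _ "exp y / 2"])
          then have "y - ln 2 \<le> ln (ln (real n))" by (simp add: ln_div)
          then have "y / 2 \<le> ln (ln (real n))" using ya ln2 by linarith
          then have "g * (y / 2) \<le> g * ln (ln (real n))" using g by (intro mult_left_mono) auto
          then show ?thesis using n(1) by (simp add: tagged_set_def)
        qed
      qed (use q WK x in auto)
      also have "exp (exp y / 2) \<le> x / W y"
      proof -
        have "exp (exp y / 2) * W y \<le> exp (exp y / 2) * exp (exp y / 2)"
          using y(2) by (intro mult_left_mono order.trans[OF y(2)]) auto
        also have "\<dots> = x" by (simp add: x flip: exp_add)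
        finally show ?thesis using Wy by (simp add: field_simps)
      qed
      also have "x / (b * W (g / 2 * y)) \<le> E1 / b * (x / W y)"
      proof -
        have "2 / g * (g / 2 * y) = y" using g by simp
        then have "W y \<le> E1 * W (g / 2 * y)" using E1(2)[of "g / 2 * y"] ga ya by simp
        then have "W y * x \<le> E1 * W (g / 2 * y) * x" by (intro mult_right_mono) (auto simp: x)
        then show ?thesis using WK Wy q(3) by (simp add: field_simps)
      qed
      finally show ?case by (simp only: y_def distrib_right mult_1)
    qed
  qed
  have lower: "\<forall>\<^sub>F x in at_top. 1 / (4 * C * E2) * (x / W (ln (ln x))) \<le> counting_fun S x"
  proof -
    have "\<forall>\<^sub>F y::real in at_top. exp (exp y / 2) + 2 \<le> exp (3 / 4 * exp y)"
      by real_asymp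
    moreover have "\<forall>\<^sub>F y::real in at_top. real N0 + 2 \<le> exp (exp y / 2)"
      by real_asymp
    ultimately have "\<forall>\<^sub>F y in at_top. a + real k0 / g + real k0 + 2 \<le> y \<and> C * E2 * W y \<le> exp (exp y / 4) \<and>
       exp (exp y / 2) + 2 \<le> exp (3 / 4 * exp y) \<and> real N0 + 2 \<le> exp (exp y / 2)"
      by (intro eventually_conj growth eventually_ge_at_top)
    then have "\<forall>\<^sub>F x in at_top. (a + real k0 / g + real k0 + 2 \<le> ln (ln x) \<and> C * E2 * W (ln (ln x)) \<le> exp (exp (ln (ln x)) / 4) \<and>
       exp (exp (ln (ln x)) / 2) + 2 \<le> exp (3 / 4 * exp (ln (ln x))) \<and> real N0 + 2 \<le> exp (exp (ln (ln x)) / 2))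
        \<and> exp (exp (ln (ln x))) = x"
      by (rule eventually_ln_ln)
    then show ?thesis
    proof eventually_elim
      case (elim x)
      define y where "y = ln (ln x)"
      have y: "a + real k0 / g + real k0 + 2 \<le> y" "C * E2 * W y \<le> exp (exp y / 4)"
          "exp (exp y / 2) + 2 \<le> exp (3 / 4 * exp y)" "real N0 + 2 \<le> exp (exp y / 2)"
        and x: "x = exp (exp y)"
        using elim by (auto simp: y_def)
      have kg: "0 \<le> real k0 / g" using g by simp
      have ya: "a \<le> y" "2 \<le> y" "real k0 \<le> y" "real k0 / g \<le> y" using y(1) kg a by linarith+
      have gk: "real k0 \<le> g * y" using ya(4) g by (simp add: field_simps)
      have Wy: "W y > 0" using ya by (intro pos)
      have "y \<le> (C1 + 1) * y" using normal ya by (simp add: algebra_simps)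
      then have yC: "a \<le> (C1 + 1) * y" "real k0 \<le> (C1 + 1) * y" using ya by linarith+
      \<comment> \<open>\<open>Q\<close> bounds every prime that can be attached to a cofactor with
        at most \<open>C1 * y\<close> prime factors, the extra \<open>y\<close> paying for the
        successor; then \<open>m \<le> N\<close> forces the product to be at most
        \<open>x\<close>.\<close>
      define Q where "Q = C * W ((C1 + 1) * y)"
      define N where "N = nat \<lfloor>x / Q\<rfloor>"
      have QE: "Q \<le> C * E2 * W y"
        using E2(2)[OF ya(1) yC(1)] q(4) by (simp add: Q_def mult.assoc)
      have q_le_Q: "real (q k) \<le> Q" if "k0 \<le> k" "real k \<le> (C1 + 1) * y" for k
      proof -
        have "C * W (real k) \<le> Q"
          unfolding Q_def using that q(2,4) by (intro mult_left_mono mono) auto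
        then show ?thesis using q(9)[OF that(1)] by linarith
      qed
      have Q1: "1 \<le> Q"
        using q_le_Q[of k0] yC(2) prime_ge_1_nat[OF q(5)[of k0]] by linarith
      \<comment> \<open>As \<open>Q\<close> is at most the fourth root of \<open>x\<close>, the
        quotient \<open>x / Q\<close> exceeds the square root of \<open>x\<close>, and so
        \<open>ln (ln N)\<close> stays between \<open>y / 2\<close> and \<open>y\<close>.\<close>
      have "exp (3 / 4 * exp y) * Q \<le> exp (3 / 4 * exp y) * exp (exp y / 4)"
        using QE y(2) by (intro mult_left_mono) auto
      also have "\<dots> = x" by (simp add: x flip: exp_add)
      finally have "exp (3 / 4 * exp y) \<le> x / Q" using Q1 by (simp add: field_simps)
      then have xQ: "exp (exp y / 2) + 2 \<le> x / Q" using y(3) by linarith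
      have N: "real N \<le> x / Q" "x / Q - 1 \<le> real N"
        using xQ Q1 exp_gt_zero[of "exp y / 2"] unfolding N_def by linarith+
      have x0: "x > 0" by (simp add: x)
      have "x / Q \<le> x / 1" using Q1 x0 by (intro divide_left_mono) auto
      then have Nx: "real N \<le> x" using N by simp
      have Nlow: "exp (exp y / 2) \<le> real N" using N xQ by linarith
      then have NN0: "N0 \<le> N" "0 < real N" using y(4) by linarith+
      have "exp y / 2 \<le> ln (real N)" using Nlow NN0 by (subst ln_ge_iff) auto
      moreover from this have lnN: "0 < ln (real N)" by (rule less_le_trans[rotated]) simp
      ultimately have "ln (exp y / 2) \<le> ln (ln (real N))" by (subst ln_le_cancel_iff) auto
      then have "y - ln 2 \<le> ln (ln (real N))" by (simp add: ln_div)
      then have llN: "y / 2 \<le> ln (ln (real N))" using ya ln2 by linarith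
      have "ln (real N) \<le> ln x" using Nx NN0 by simp
      then have llNu: "ln (ln (real N)) \<le> y" unfolding y_def using lnN by simp
      define B1 where "B1 = {m \<in> {1..N}. real (big_omega m) < c1 * ln (ln (real N))}"
      define B2 where "B2 = {m \<in> {1..N}. real (big_omega m) > C1 * ln (ln (real N))}"
      define B3 where "B3 = {m \<in> {1..N}. \<exists>j\<ge>k0. q j dvd m}"
      define G where "G = {1..N} - B1 - B2 - B3"
      have "real (card B3) \<le> 1 / 4 * real N"
        unfolding B3_def using q prime_gt_0_nat by (intro card_multiples_of_sequence_le) auto
      moreover have "real (card B1) \<le> real N / 8" "real (card B2) \<le> real N / 8"
        using N0[OF NN0(1)] by (auto simp: B1_def B2_def)
      moreover have "N \<le> card G + card B1 + card B2 + card B3"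
      proof -
        have "card {1..N} \<le> card (G \<union> B1 \<union> B2 \<union> B3)"
          by (intro card_mono) (auto simp: G_def B1_def B2_def B3_def)
        also have "\<dots> \<le> card (G \<union> B1 \<union> B2) + card B3" by (rule card_Un_le)
        also have "\<dots> \<le> card (G \<union> B1) + card B2 + card B3" by (intro add_right_mono card_Un_le)
        also have "\<dots> \<le> card G + card B1 + card B2 + card B3" by (intro add_right_mono card_Un_le)
        finally show ?thesis by simp
      qed
      \<comment> \<open>The exceptional sets take up at most \<open>1 / 8 + 1 / 8 + 1 / 4\<close> of
        \<open>{1..N}\<close>.\<close>
      ultimately have cardG: "real N / 2 \<le> real (card G)" by linarith
      have "real (card G) \<le> counting_fun S x"
        unfolding S_def
      proof (rule counting_tagged_set_ge[OF q(5) q(6)])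
        fix m assume "m \<in> G"
        then have m: "m \<in> {1..N}" "c1 * ln (ln (real N)) \<le> real (big_omega m)"
          "real (big_omega m) \<le> C1 * ln (ln (real N))" "\<forall>j\<ge>k0. \<not> q j dvd m"
          by (auto simp: G_def B1_def B2_def B3_def not_less)
        have "c1 * (y / 2) \<le> c1 * ln (ln (real N))" using llN normal by (intro mult_left_mono) auto
        then have gm: "g * y \<le> real (big_omega m)" using m(2) by (simp add: g_def)
        then have km: "k0 \<le> big_omega m" using gk by linarith
        have "C1 * ln (ln (real N)) \<le> C1 * y" using llNu normal by (intro mult_left_mono) auto
        then have "real (Suc (big_omega m)) \<le> (C1 + 1) * y" using m(3) ya by (simp add: algebra_simps)
        then have "real (q (Suc (big_omega m))) \<le> Q" using km by (intro q_le_Q) auto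
        then have "real (q (Suc (big_omega m)) * m) \<le> Q * (x / Q)"
          unfolding of_nat_mult using m(1) N(1) Q1 by (intro mult_mono) auto
        then have "real (q (Suc (big_omega m)) * m) \<le> x" using Q1 by simp
        then show "m > 0 \<and> k0 \<le> big_omega m \<and> real (q (Suc (big_omega m)) * m) \<le> x \<and>
            g * ln (ln x) \<le> real (big_omega m) \<and> (\<forall>j\<ge>k0. \<not> q j dvd m)"
          using m km gm by (auto simp: y_def)
      qed (use g in auto)
      then have "real N / 2 \<le> counting_fun S x" using cardG by linarith
      moreover have "x / Q \<le> 2 * real N" using N xQ exp_gt_zero[of "exp y / 2"] by linarith
      moreover have "x / (C * E2 * W y) \<le> x / Q"
        using QE Q1 x0 by (intro divide_left_mono) auto
      \<comment> \<open>One factor 2 comes from \<open>card G \<ge> N / 2\<close>, the other from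
        the floor in \<open>N\<close>.\<close>
      ultimately have "x / (C * E2 * W y) \<le> 4 * counting_fun S x" by linarith
      then have "x / (C * E2 * W y) / 4 \<le> counting_fun S x" by simp
      then show ?case by (simp add: y_def mult.assoc mult.commute mult.left_commute)
    qed
  qed
  have "same_order_at_top (counting_fun S) (\<lambda>x. x / W (ln (ln x)))"
    unfolding same_order_at_top_def
  proof (intro exI conjI)
    show "0 < 1 / (4 * C * E2)" "0 < 1 + E1 / b" using q E1 E2 by (auto intro!: add_pos_pos)
    show "\<forall>\<^sub>F x in at_top. 1 / (4 * C * E2) * (x / W (ln (ln x))) \<le> counting_fun S x \<and>
        counting_fun S x \<le> (1 + E1 / b) * (x / W (ln (ln x)))"
      using lower upper by eventually_elim simp
  qed
  then show ?thesis using primitive_tagged_set S_def by blast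
qed

end

section \<open>Iterated logarithms and the theorem\<close>

lemma same_order_at_top_cong:
  assumes "same_order_at_top f g" "\<forall>\<^sub>F x in at_top. g x = h x"
  shows "same_order_at_top f h"
proof -
  obtain c C where "c > 0" "C > 0" and ev: "\<forall>\<^sub>F x in at_top. c * g x \<le> f x \<and> f x \<le> C * g x"
    using assms(1) unfolding same_order_at_top_def by blast
  moreover have "\<forall>\<^sub>F x in at_top. c * h x \<le> f x \<and> f x \<le> C * h x"
    using ev assms(2) by eventually_elim simp
  ultimately show ?thesis unfolding same_order_at_top_def by blast
qed

text \<open>One direction of the integral test: \<open>f (n + 3)\<close> is below the integral over
  \<open>(n + 2, n + 3]\<close>. The shift by 3 keeps these intervals inside
  \<open>{2..}\<close>.\<close>

lemma summable_if_set_integrable_antimono: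
  fixes f :: "real \<Rightarrow> real"
  assumes int: "set_integrable lborel {2..} f"
    and nonneg: "\<And>x. 2 \<le> x \<Longrightarrow> 0 \<le> f x"
    and antimono: "\<And>x y. 2 \<le> x \<Longrightarrow> x \<le> y \<Longrightarrow> f y \<le> f x"
  shows "summable (\<lambda>k. f (real k))"
proof -
  have sub: "set_integrable lborel A f" if "A \<in> sets lborel" "A \<subseteq> {2..}" for A
    using set_integrable_subset[OF int] that by blast
  have step: "f (real n + 3) \<le> (LINT t:{real n + 2<..real n + 3}|lborel. f t)" for n
  proof -
    have "f (real n + 3) = (LINT t:{real n + 2<..real n + 3}|lborel. f (real n + 3))"
      by (simp add: set_lebesgue_integral_def)
    also have "\<dots> \<le> (LINT t:{real n + 2<..real n + 3}|lborel. f t)"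
    proof (rule set_integral_mono)
      show "set_integrable lborel {real n + 2<..real n + 3} f" by (rule sub) auto
      show "set_integrable lborel {real n + 2<..real n + 3} (\<lambda>t. f (real n + 3))"
        by (simp add: set_integrable_def)
    qed (auto intro!: antimono)
    finally show ?thesis .
  qed
  have "(\<Sum>k<n. f (real k + 3)) \<le> (LINT t:{2<..real n + 2}|lborel. f t)" for n
  proof (induction n)
    case (Suc n)
    have eq: "{2<..real (Suc n) + 2} = {2<..real n + 2} \<union> {real n + 2<..real n + 3}" by auto
    have "(LINT t:{2<..real (Suc n) + 2}|lborel. f t)
        = (LINT t:{2<..real n + 2}|lborel. f t) + (LINT t:{real n + 2<..real n + 3}|lborel. f t)"
      unfolding eq by (intro set_integral_Un sub) auto
    then show ?case using Suc step[of n] by simp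
  qed (simp add: set_lebesgue_integral_def)
  also have "(LINT t:{2<..real n + 2}|lborel. f t) \<le> (LINT t:{2..}|lborel. f t)" for n
    unfolding set_lebesgue_integral_def
  proof (rule integral_mono)
    show "integrable lborel (\<lambda>t. indicator {2<..real n + 2} t *\<^sub>R f t)"
      unfolding set_integrable_def[symmetric] by (rule sub) auto
    show "integrable lborel (\<lambda>t. indicator {2..} t *\<^sub>R f t)"
      using int by (simp add: set_integrable_def)
  qed (auto simp: indicator_def nonneg)
  finally have "(\<Sum>k<n. f (real k + 3)) \<le> (LINT t:{2..}|lborel. f t)" for n .
  then have "summable (\<lambda>k. f (real k + 3))"
    by (intro summableI_nonneg_bounded) (auto intro!: nonneg)
  then show ?thesis
    using summable_iff_shift[of "\<lambda>k. f (real k)" 3] by simp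
qed

text \<open>Once \<open>ln x\<close> and \<open>ln (ln x)\<close> are at least 1, the first two
  truncations are inactive; this range of \<open>x\<close> serves all \<open>j\<close> at
  once.\<close>

lemma iter_log_add_2:
  "\<forall>\<^sub>F x in at_top. \<forall>j. iter_log (j + 2) x = iter_log j (ln (ln x))"
proof -
  have "\<forall>\<^sub>F x::real in at_top. 1 \<le> ln x" by real_asymp
  moreover have "\<forall>\<^sub>F x::real in at_top. 1 \<le> ln (ln x)" by real_asymp
  ultimately show ?thesis
  proof eventually_elim
    case (elim x)
    have "iter_log (j + 2) x = iter_log j (ln (ln x))" for j
      by (induction j) (use elim in \<open>simp_all add: numeral_2_eq_2\<close>)
    then show ?case by blast
  qed
qed

lemma primitive_set_of_integral:
  fixes L :: "real \<Rightarrow> real"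
  assumes pos: "\<And>x. x \<ge> 2 \<Longrightarrow> L x > 0" and L_mono: "mono_on {2..} L"
    and slow: "asymp_equiv (\<lambda>x. L (2 * x)) at_top L"
    and int: "set_integrable lborel {2..} (\<lambda>t. 1 / (t * ln t * L t))"
  shows "\<exists>S. primitive_set S \<and>
    same_order_at_top (counting_fun S) (\<lambda>x. x / (iter_log 2 x * iter_log 3 x * L (iter_log 2 x)))"
proof -
  define W where "W y = y * ln y * L y" for y
  have L_le: "L x \<le> L y" if "2 \<le> x" "x \<le> y" for x y
    using L_mono that by (auto simp: mono_on_def)
  have W_mono: "W x \<le> W y" if "2 \<le> x" "x \<le> y" for x y
    unfolding W_def using that pos[of x] L_le[of x y] by (intro mult_mono) auto
  have W_pos: "W x > 0" if "2 \<le> x" for x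
    unfolding W_def using that pos[of x] by simp
  \<comment> \<open>The ratio in \<open>asymp_equiv\<close> is set to 1 where both functions vanish,
    which positivity of \<open>L\<close> rules out. Its limit 1 yields
    \<open>L (2 * x) \<le> 2 * L x\<close>.\<close>
  have "\<forall>\<^sub>F x in at_top. (if L (2 * x) = 0 \<and> L x = 0 then 1 else L (2 * x) / L x) < 2"
    using asymp_equivD[OF slow] by (rule order_tendstoD) simp
  then obtain a0 where a0: "\<And>x. x \<ge> a0 \<Longrightarrow> (if L (2 * x) = 0 \<and> L x = 0 then 1 else L (2 * x) / L x) < 2"
    unfolding eventually_at_top_linorder by blast
  define a where "a = max 2 a0"
  have a: "a \<ge> 2" "a \<ge> a0" by (auto simp: a_def)
  \<comment> \<open>Each of the three factors of \<open>W\<close> at most doubles, which gives 8;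
    \<open>L 2\<close> is the minimum of \<open>L\<close> on \<open>{2..}\<close>.\<close>
  have "slow_weight W a (L 2) 8"
  proof
    show "2 \<le> a" by (rule a)
    show "0 < L 2" by (rule pos) simp
    show "W x \<le> W y" if "a \<le> x" "x \<le> y" for x y using that a by (intro W_mono) auto
    show "L 2 * (x * ln x) \<le> W x" if "a \<le> x" for x
    proof -
      have "(x * ln x) * L 2 \<le> (x * ln x) * L x"
        using that a by (intro mult_left_mono L_le) auto
      then show ?thesis by (simp add: W_def mult.commute)
    qed
    show "W (2 * x) \<le> 8 * W x" if x: "a \<le> x" for x
    proof -
      have x2: "2 \<le> x" using x a by simp
      have "L (2 * x) \<le> 2 * L x" using a0[of x] x a pos[of x] pos[of "2 * x"] x2
        by (auto simp: field_simps)
      moreover have "ln (2 * x) \<le> 2 * ln x"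
      proof -
        have "ln 2 \<le> ln x" using x2 by simp
        then show ?thesis using x2 by (simp add: ln_mult)
      qed
      ultimately have "(2 * x) * ln (2 * x) * L (2 * x) \<le> (2 * x) * (2 * ln x) * (2 * L x)"
        using x2 pos[of x] pos[of "2 * x"] by (intro mult_mono) (auto intro!: mult_nonneg_nonneg)
      then show ?thesis by (simp add: W_def)
    qed
    show "summable (\<lambda>k. 1 / W (real k))"
    proof (rule summable_if_set_integrable_antimono)
      show "set_integrable lborel {2..} (\<lambda>t. 1 / W t)" using int by (simp add: W_def)
      show "1 / W y \<le> 1 / W x" if "2 \<le> x" "x \<le> y" for x y
        using that W_pos[of x] W_mono[of x y] by (intro divide_left_mono mult_pos_pos) auto
    qed (use W_pos less_imp_le in auto)
  qed
  then obtain S where S: "primitive_set S" "same_order_at_top (counting_fun S) (\<lambda>x. x / W (ln (ln x)))"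
    using slow_weight.primitive_set_exists by blast
  have "\<forall>\<^sub>F x::real in at_top. 1 \<le> ln (ln (ln x))" by real_asymp
  then have "\<forall>\<^sub>F x in at_top. x / W (ln (ln x)) = x / (iter_log 2 x * iter_log 3 x * L (iter_log 2 x))"
    using iter_log_add_2
  proof eventually_elim
    case (elim x)
    have "iter_log 2 x = ln (ln x)"
      using elim(2)[rule_format, of 0] by (simp only: add_0 iter_log.simps(1))
    moreover have "iter_log 3 x = ln (ln (ln x))"
      using elim(2)[rule_format, of 1] elim(1) by (simp add: numeral_3_eq_3)
    ultimately show ?case by (simp add: W_def)
  qed
  then have "same_order_at_top (counting_fun S)
      (\<lambda>x. x / (iter_log 2 x * iter_log 3 x * L (iter_log 2 x)))"
    by (rule same_order_at_top_cong[OF S(2)])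
  with S(1) show ?thesis by blast
qed

section \<open>Weights built from iterated logarithms\<close>

lemma iter_log_pos: "0 < x \<Longrightarrow> 0 < iter_log j x"
  by (cases j) auto

lemma iter_log_mono: "0 < x \<Longrightarrow> x \<le> y \<Longrightarrow> iter_log j x \<le> iter_log j y"
proof (induction j)
  case (Suc j)
  then have "ln (iter_log j x) \<le> ln (iter_log j y)"
    using iter_log_pos[of x j] iter_log_pos[of y j] by simp
  then show ?case by auto
qed simp

lemma iter_log_double: "0 < x \<Longrightarrow> iter_log j (2 * x) \<le> 2 * iter_log j x"
proof (induction j)
  case (Suc j)
  have "ln (iter_log j (2 * x)) \<le> ln (2 * iter_log j x)"
    using Suc iter_log_pos[of "2 * x" j] iter_log_pos[of x j] by (subst ln_le_cancel_iff) auto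
  also have "\<dots> = ln 2 + ln (iter_log j x)"
    using Suc iter_log_pos[of x j] by (simp add: ln_mult)
  finally show ?case using ln_2_less_1 by (auto simp: max_def)
qed simp

lemma filterlim_iter_log: "filterlim (iter_log j) at_top at_top"
proof (induction j)
  case (Suc j)
  have "filterlim (\<lambda>x. ln (iter_log j x)) at_top at_top"
    by (rule filterlim_compose[OF ln_at_top Suc])
  then show ?case by (rule filterlim_at_top_mono) auto
qed (simp add: filterlim_ident)

text \<open>The chain rule, valid only beyond a threshold depending on \<open>j\<close> where no
  truncation is active. It provides the antiderivative behind
  \<open>iter_log_weight_summable\<close>.\<close>

lemma iter_log_deriv:
  "\<exists>T. \<forall>t>T. (iter_log j has_real_derivative 1 / (\<Prod>i<j. iter_log i t)) (at t)"
proof (induction j)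
  case 0
  then show ?case by (auto intro!: exI[of _ 0] derivative_eq_intros)
next
  case (Suc j)
  then obtain T where T: "\<And>t. t > T \<Longrightarrow> (iter_log j has_real_derivative 1 / (\<Prod>i<j. iter_log i t)) (at t)"
    by blast
  have "\<forall>\<^sub>F t in at_top. exp 1 \<le> iter_log j t"
    using filterlim_iter_log by (simp add: filterlim_at_top)
  then obtain T2 where T2: "\<And>t. t \<ge> T2 \<Longrightarrow> exp 1 \<le> iter_log j t"
    unfolding eventually_at_top_linorder by blast
  have "(iter_log (Suc j) has_real_derivative 1 / (\<Prod>i<Suc j. iter_log i t)) (at t)"
    if t: "t > max T T2" for t
  proof -
    have j0: "0 < iter_log j s" if "s > max T T2" for s
      using T2[of s] that exp_gt_zero[of "1::real"] by linarith
    have "((\<lambda>s. ln (iter_log j s)) has_real_derivative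
        1 / (\<Prod>i<j. iter_log i t) / iter_log j t) (at t)"
      using T[of t] t j0[OF t] by (auto intro!: derivative_eq_intros)
    then have "((\<lambda>s. ln (iter_log j s)) has_real_derivative 1 / (\<Prod>i<Suc j. iter_log i t)) (at t)"
      by simp
    then show ?thesis
    proof (rule has_field_derivative_transform_within_open)
      show "open {max T T2<..}" by simp
      show "t \<in> {max T T2<..}" using t by simp
      fix s assume s: "s \<in> {max T T2<..}"
      then have "1 \<le> ln (iter_log j s)" using T2[of s] j0[of s] by (subst ln_ge_iff) auto
      then show "ln (iter_log j s) = iter_log (Suc j) s" by simp
    qed
  qed
  then show ?case by blast
qed

text \<open>The denominator for \<open>l = m + 3\<close> after substituting
  \<open>y = ln (ln x)\<close>, which lowers every index by 2.\<close>

definition iter_log_weight :: "nat \<Rightarrow> real \<Rightarrow> real \<Rightarrow> real" where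
  "iter_log_weight m \<epsilon> y = (\<Prod>j\<le>m. iter_log j y) * iter_log (Suc m) y powr (1 + \<epsilon>)"

lemma iter_log_weight_pos: "0 < y \<Longrightarrow> 0 < iter_log_weight m \<epsilon> y"
  unfolding iter_log_weight_def using iter_log_pos[of y]
  by (intro mult_pos_pos prod_pos) (auto simp: less_imp_neq[OF iter_log_pos, symmetric])

lemma iter_log_weight_mono:
  assumes "0 < x" "x \<le> y" "\<epsilon> \<ge> 0"
  shows "iter_log_weight m \<epsilon> x \<le> iter_log_weight m \<epsilon> y"
  unfolding iter_log_weight_def
  using assms iter_log_pos[of x] iter_log_pos[of y] less_imp_le[OF iter_log_pos] iter_log_mono
  by (intro mult_mono prod_mono powr_mono2 conjI prod_nonneg) (auto simp del: iter_log.simps)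

text \<open>The function \<open>G\<close> has derivative \<open>- \<epsilon> / W\<close>, so by the
  mean value theorem each term is at most a difference of consecutive values of \<open>G\<close>,
  divided by \<open>\<epsilon>\<close>, and the sum telescopes.\<close>

lemma iter_log_weight_summable:
  assumes \<epsilon>: "\<epsilon> > 0"
  shows "summable (\<lambda>k. 1 / iter_log_weight m \<epsilon> (real k))"
proof -
  let ?W = "iter_log_weight m \<epsilon>"
  define G where "G t = iter_log (Suc m) t powr (- \<epsilon>)" for t
  obtain T where T: "\<And>t. t > T \<Longrightarrow> (iter_log (Suc m) has_real_derivative 1 / (\<Prod>i<Suc m. iter_log i t)) (at t)"
    using iter_log_deriv by blast
  have deriv: "(G has_real_derivative - \<epsilon> / ?W t) (at t)" if t: "t > T" "t > 0" for t
  proof -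
    let ?F = "iter_log (Suc m) t"
    have F: "?F > 0" using iter_log_pos t by blast
    have "((\<lambda>s. iter_log (Suc m) s powr (- \<epsilon>)) has_real_derivative
        (- \<epsilon>) * ?F powr (- \<epsilon> - 1) * (1 / (\<Prod>i<Suc m. iter_log i t))) (at t)"
      using DERIV_fun_powr[OF T[OF t(1)] F, of "- \<epsilon>"] by simp
    also have "(\<lambda>s. iter_log (Suc m) s powr (- \<epsilon>)) = G" by (simp only: G_def[abs_def])
    also have "?F powr (- \<epsilon> - 1) = 1 / ?F powr (1 + \<epsilon>)"
      using powr_minus_divide[of ?F "1 + \<epsilon>"] by (simp only: minus_add_distrib add.commute diff_conv_add_uminus)
    also have "(- \<epsilon>) * (1 / ?F powr (1 + \<epsilon>)) * (1 / (\<Prod>i<Suc m. iter_log i t)) = - \<epsilon> / ?W t"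
      by (simp only: iter_log_weight_def lessThan_Suc_atMost) simp
    finally show ?thesis .
  qed
  define K where "K = nat \<lceil>T\<rceil> + 1"
  have K: "real K > T" "real K > 0" unfolding K_def by linarith+
  have step: "1 / ?W (real k + 1) \<le> (G (real k) - G (real k + 1)) / \<epsilon>" if k: "k \<ge> K" for k
  proof -
    have "\<exists>z. real k < z \<and> z < real k + 1 \<and> G (real k + 1) - G (real k) = (real k + 1 - real k) * (- \<epsilon> / ?W z)"
      using k K by (intro MVT2 deriv) auto
    then obtain z where z: "real k < z" "z < real k + 1" "G (real k) - G (real k + 1) = \<epsilon> / ?W z"
      by (auto simp: algebra_simps)
    have z0: "z > 0" using z k K by linarith
    have "1 / ?W (real k + 1) \<le> 1 / ?W z"
      using z z0 \<epsilon> by (intro divide_left_mono mult_pos_pos iter_log_weight_mono iter_log_weight_pos) auto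
    then show ?thesis using z(3) \<epsilon> by simp
  qed
  have "(\<Sum>k<n. 1 / ?W (real (k + (K + 1)))) \<le> (G (real K) - G (real (n + K))) / \<epsilon>" for n
  proof (induction n)
    case (Suc n)
    then show ?case using step[of "n + K"]
      by (simp add: diff_divide_distrib add_ac)
  qed simp
  also have "(G (real K) - G (real (n + K))) / \<epsilon> \<le> G (real K) / \<epsilon>" for n
    using \<epsilon> by (intro divide_right_mono) (auto simp: G_def)
  finally have "(\<Sum>k<n. 1 / ?W (real (k + (K + 1)))) \<le> G (real K) / \<epsilon>" for n .
  then have "summable (\<lambda>k. 1 / ?W (real (k + (K + 1))))"
    by (intro summableI_nonneg_bounded) (auto intro!: less_imp_le[OF iter_log_weight_pos])
  then show ?thesis
    using summable_iff_shift[of "\<lambda>k. 1 / ?W (real k)" "K + 1"] by simp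
qed

lemma slow_weight_iter_log:
  assumes \<epsilon>: "\<epsilon> > 0"
  shows "slow_weight (iter_log_weight m \<epsilon>) 2 1 (2 ^ Suc m * 2 powr (1 + \<epsilon>))"
proof
  let ?W = "iter_log_weight m \<epsilon>"
  show "?W x \<le> ?W y" if "2 \<le> x" "x \<le> y" for x y
    using that \<epsilon> by (intro iter_log_weight_mono) auto
  show "1 * (x * ln x) \<le> ?W x" if x: "2 \<le> x" for x
  proof -
    \<comment> \<open>Factors 0 and 1 already give \<open>x * ln x\<close>; all later ones are at
      least 1 by truncation.\<close>
    have "x * ln x \<le> (\<Prod>j\<le>Suc n. iter_log j x)" for n
    proof (induction n)
      case 0
      show ?case using x by (simp add: mult_left_mono)
    next
      case (Suc n)
      have "(\<Prod>j\<le>Suc n. iter_log j x) * 1 \<le> (\<Prod>j\<le>Suc n. iter_log j x) * iter_log (Suc (Suc n)) x"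
      proof (rule mult_left_mono)
        show "0 \<le> (\<Prod>j\<le>Suc n. iter_log j x)"
          using x by (intro prod_nonneg less_imp_le[OF iter_log_pos]) simp
      qed simp
      with Suc show ?case by (simp only: prod.atMost_Suc)
    qed
    then have "x * ln x \<le> (\<Prod>j\<le>m. iter_log j x) * iter_log (Suc m) x"
      by (simp only: prod.atMost_Suc)
    also have "\<dots> \<le> ?W x" unfolding iter_log_weight_def
    proof (rule mult_left_mono)
      have "iter_log (Suc m) x powr 1 \<le> iter_log (Suc m) x powr (1 + \<epsilon>)"
        using \<epsilon> by (intro powr_mono) auto
      then show "iter_log (Suc m) x \<le> iter_log (Suc m) x powr (1 + \<epsilon>)" by simp
    qed (use x in \<open>auto intro!: prod_nonneg less_imp_le[OF iter_log_pos]\<close>)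
    finally show ?thesis by simp
  qed
  show "?W (2 * x) \<le> 2 ^ Suc m * 2 powr (1 + \<epsilon>) * ?W x" if x: "2 \<le> x" for x
  proof -
    have x0: "0 < x" using x by simp
    have nn: "0 \<le> iter_log j y" if "0 < y" for j y using iter_log_pos[OF that] by (rule less_imp_le)
    have "(\<Prod>j\<le>m. iter_log j (2 * x)) \<le> (\<Prod>j\<le>m. 2 * iter_log j x)"
      using iter_log_double[OF x0] nn[of "2 * x"] x0 by (intro prod_mono) auto
    also have "\<dots> = 2 ^ Suc m * (\<Prod>j\<le>m. iter_log j x)" by (simp add: prod.distrib)
    finally have 1: "(\<Prod>j\<le>m. iter_log j (2 * x)) \<le> 2 ^ Suc m * (\<Prod>j\<le>m. iter_log j x)" .
    have "iter_log (Suc m) (2 * x) powr (1 + \<epsilon>) \<le> (2 * iter_log (Suc m) x) powr (1 + \<epsilon>)"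
      using \<epsilon> nn[of "2 * x"] x0 iter_log_double[OF x0] by (intro powr_mono2) (auto simp del: iter_log.simps)
    also have "\<dots> = 2 powr (1 + \<epsilon>) * iter_log (Suc m) x powr (1 + \<epsilon>)"
      using nn[OF x0] by (intro powr_mult)
    finally have 2: "iter_log (Suc m) (2 * x) powr (1 + \<epsilon>) \<le> 2 powr (1 + \<epsilon>) * iter_log (Suc m) x powr (1 + \<epsilon>)" .
    have "?W (2 * x) \<le> (2 ^ Suc m * (\<Prod>j\<le>m. iter_log j x)) * (2 powr (1 + \<epsilon>) * iter_log (Suc m) x powr (1 + \<epsilon>))"
      unfolding iter_log_weight_def using 1 2 nn[OF x0]
      by (intro mult_mono) (auto intro!: mult_nonneg_nonneg prod_nonneg)
    then show ?thesis by (simp add: iter_log_weight_def mult_ac)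
  qed
  show "summable (\<lambda>k. 1 / ?W (real k))" by (rule iter_log_weight_summable[OF \<epsilon>])
qed auto

lemma primitive_set_of_iter_log:
  assumes l: "l \<ge> 3" and \<epsilon>: "\<epsilon> > 0"
  shows "\<exists>S. primitive_set S \<and>
    same_order_at_top (counting_fun S)
      (\<lambda>x. x / ((\<Prod>j=2..l-1. iter_log j x) * iter_log l x powr (1 + \<epsilon>)))"
proof -
  obtain m where m: "l = m + 3" using l le_Suc_ex by (metis add.commute)
  obtain S where S: "primitive_set S"
    "same_order_at_top (counting_fun S) (\<lambda>x. x / iter_log_weight m \<epsilon> (ln (ln x)))"
    using slow_weight.primitive_set_exists[OF slow_weight_iter_log[OF \<epsilon>]] by blast
  have "\<forall>\<^sub>F x in at_top. x / iter_log_weight m \<epsilon> (ln (ln x))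
      = x / ((\<Prod>j=2..l-1. iter_log j x) * iter_log l x powr (1 + \<epsilon>))"
    using iter_log_add_2
  proof eventually_elim
    case (elim x)
    have "l - 1 = m + 2" by (simp add: m)
    then have "(\<Prod>j=2..l-1. iter_log j x) = (\<Prod>j=0+2..m+2. iter_log j x)" by (simp only: add_0)
    also have "\<dots> = (\<Prod>j=0..m. iter_log (j + 2) x)" by (rule prod.shift_bounds_cl_nat_ivl)
    also have "\<dots> = (\<Prod>j\<le>m. iter_log j (ln (ln x)))"
      using elim by (simp only: atLeast0AtMost)
    finally have "(\<Prod>j=2..l-1. iter_log j x) = (\<Prod>j\<le>m. iter_log j (ln (ln x)))" .
    moreover have "iter_log l x = iter_log (Suc m) (ln (ln x))"
      using elim[rule_format, of "Suc m"] by (simp only: m) (simp add: numeral_3_eq_3 numeral_2_eq_2)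
    ultimately show ?case by (simp only: iter_log_weight_def)
  qed
  then have "same_order_at_top (counting_fun S)
      (\<lambda>x. x / ((\<Prod>j=2..l-1. iter_log j x) * iter_log l x powr (1 + \<epsilon>)))"
    by (rule same_order_at_top_cong[OF S(2)])
  with S(1) show ?thesis by blast
qed

theorem theorem1:
  shows "(\<forall>L :: real \<Rightarrow> real.
            (\<forall>x\<ge>2. L x > 0) \<and>
            mono_on {2..} L \<and>
            asymp_equiv (\<lambda>x. L (2 * x)) at_top L \<and>
            set_integrable lborel {2..} (\<lambda>t. 1 / (t * ln t * L t)) \<longrightarrow>
            (\<exists>S. primitive_set S \<and>
              same_order_at_top (counting_fun S)
                (\<lambda>x. x / (iter_log 2 x * iter_log 3 x * L (iter_log 2 x))))) \<and>
         (\<forall>l::nat. \<forall>\<epsilon>::real. l \<ge> 3 \<and> \<epsilon> > 0 \<longrightarrow>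
            (\<exists>S. primitive_set S \<and>
              same_order_at_top (counting_fun S)
                (\<lambda>x. x / ((\<Prod>j=2..l-1. iter_log j x) * iter_log l x powr (1 + \<epsilon>)))))"
  using primitive_set_of_integral primitive_set_of_iter_log by blast

end
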